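(* Let $\hat f_{NN}$ be the two-sample weighted $K$-NN classifier (defined in the context) with $$w_Q = \left(n_P^{\frac{2\beta+d}{2\gamma\beta+d}}+n_Q\right)^{-\frac{\beta}{2\beta+d}},\qquad w_P = \left(n_P^{\frac{2\beta+d}{2\gamma\beta+d}}+n_Q\right)^{-\frac{\gamma\beta}{2\beta+d}},$$ $$k_Q = \left\lfloor n_Q\left(n_P^{\frac{2\beta+d}{2\gamma\beta+d}}+n_Q\right)^{-\frac{d}{2\beta+d}} \right\rfloor,\qquad k_P = \left\lfloor n_P\left(n_P^{\frac{2\beta+d}{2\gamma\beta+d}}+n_Q\right)^{-\frac{d}{2\beta+d}}\right\rfloor .$$ Then there is a constant $C>0$ not depending on $n_P$ or $n_Q$ such that $$\sup_{(P,Q)\in\Pi}\mathbb{E}\,\mathcal{E}_Q(\hat f_{NN}) \le C\left(n_P^{\frac{2\beta+d}{2\gamma\beta+d}}+n_Q\right)^{-\frac{\beta(1+\alpha)}{2\beta+d}} .$$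
   Context: **Data.** $d\ge 1$; $P$ and $Q$ are probability distributions of a pair $(X,Y)$ on $[0,1]^d\times\{0,1\}$, with $X$-marginals $P_X,Q_X$. One observes $n_P$ i.i.d. pairs $(X_i^P,Y_i^P)\sim P$ and $n_Q$ i.i.d. pairs $(X_i^Q,Y_i^Q)\sim Q$, all mutually independent ($n_P,n_Q\ge 0$ integers, $n_P+n_Q\ge1$). $\mathbb{E}$ is expectation over all observed data. **Regression functions and risk.** $\eta_P(x)=P(Y=1|X=x)$ for $x\in\mathrm{supp}(P_X)$ and $\tfrac12$ otherwise; $\eta_Q$ is defined likewise from $Q$. The Bayes classifier is $f_Q^*(x)=0$ if $\eta_Q(x)\le \frac12$ and $1$ otherwise. For a classifier $\hat f$ (with values in $\{0,1\}$), $R_Q(\hat f)=\mathbb{P}_{(X,Y)\sim Q}(Y\ne\hat f(X))$ and the excess risk is $\mathcal{E}_Q(\hat f)=R_Q(\hat f)-R_Q(f_Q^* )$. **Parameter space.** Fix $\alpha\ge 0$, $C_\alpha>0$, $0<\beta\le 1$, $C_\beta>0$, $\gamma>0$, $C_\gamma>0$, $\mu=(\mu_-,\mu_+)$ with $0<\mu_-<\mu_+$, $c_\mu>0$, $r_\mu>0$, with $\alpha\beta\le d$. $\Pi$ is the set of pairs $(P,Q)$ such that: (i) (relative signal exponent) for all $x\in \mathrm{supp}(P_X)\cup\mathrm{supp}(Q_X)$: $(\eta_P(x)-\frac12)(\eta_Q(x)-\frac12)\ge0$ and $|\eta_P(x)-\frac12|\ge C_\gamma|\eta_Q(x)-\frac12|^\gamma$;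 (ii) (margin) $Q_X(0<|\eta_Q(X)-\frac12|<t)\le C_\alpha t^\alpha$ for all $t>0$; (iii) (smoothness) $|\eta_Q(x_1)-\eta_Q(x_2)|\le C_\beta\|x_1-x_2\|^\beta$ for all $x_1,x_2\in\mathrm{supp}(Q_X)$ (Euclidean norm); (iv) (common support and strong density) $P_X,Q_X$ are absolutely continuous with respect to Lebesgue measure $\lambda$ on $\mathbb{R}^d$, $\Omega:=\mathrm{supp}(P_X)=\mathrm{supp}(Q_X)$, $\lambda[\Omega\cap B(x,r)]\ge c_\mu\lambda[B(x,r)]$ for all $0<r\le r_\mu$, $x\in\Omega$, and $\mu_-<\frac{dP_X}{d\lambda}(x)<\mu_+$, $\mu_-<\frac{dQ_X}{d\lambda}(x)<\mu_+$ for all $x\in\Omega$. **Two-sample weighted $K$-NN classifier.** Let $X^P_{(i)}(x)$ be the $i$-th nearest covariate to $x$ among $X_1^P,\dots,X_{n_P}^P$ and $Y^P_{(i)}(x)$ its label; define $X^Q_{(i)}(x),Y^Q_{(i)}(x)$ likewise from the $Q$-data. For weights $w_P,w_Q$ and numbers of neighbours $k_P,k_Q$, $$\hat\eta_{NN}(x)=\frac{w_P\sum_{i=1}^{k_P}Y^P_{(i)}(x)+w_Q\sum_{i=1}^{k_Q}Y^Q_{(i)}(x)}{w_Pk_P+w_Qk_Q},\qquad \hat f_{NN}(x)=\mathbb{I}\{\hat\eta_{NN}(x)>\tfrac12\}.$$ If $k_P=k_Q=0$ set $\hat\eta_{NN}(x)=\frac12$. *)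

theory Defs
  imports "HOL-Probability.Probability"
begin

text \<open>
  A labelled point is an element of \<open>(real ^ 'd) \<times> bool\<close>; the label \<open>True\<close> stands for 1 and
  \<open>False\<close> for 0.  The ambient dimension is \<open>CARD('d)\<close>.
\<close>

abbreviation labelled_space :: "((real ^ 'd) \<times> bool) measure" where
  "labelled_space \<equiv> borel \<Otimes>\<^sub>M count_space UNIV"

definition unit_cube :: "(real ^ 'd) set" where
  "unit_cube = {x. \<forall>i. 0 \<le> x $ i \<and> x $ i \<le> 1}"

definition labelled_distribution :: "((real ^ 'd) \<times> bool) measure \<Rightarrow> bool" where
  "labelled_distribution P \<longleftrightarrow>
     prob_space P \<and> sets P = sets labelled_space \<and> (AE z in P. fst z \<in> unit_cube)"

definition X_marginal :: "((real ^ 'd) \<times> bool) measure \<Rightarrow> (real ^ 'd) measure" where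
  "X_marginal P = distr P borel fst"

definition measure_support :: "'a::metric_space measure \<Rightarrow> 'a set" where
  "measure_support M = {x. \<forall>r>0. emeasure M (ball x r) > 0}"

text \<open>
  A conditional probability is determined only up to null sets, while the conditions on the
  parameter space are pointwise.  So the predicate below singles out the versions of
  \<open>x \<mapsto> P(Y = 1 | X = x)\<close>, extended by 1/2 off the support of the marginal.
\<close>

definition regression_function ::
    "((real ^ 'd) \<times> bool) measure \<Rightarrow> (real ^ 'd \<Rightarrow> real) \<Rightarrow> bool" where
  "regression_function P \<eta> \<longleftrightarrow>
     \<eta> \<in> borel_measurable borel \<and>
     (\<forall>x. 0 \<le> \<eta> x \<and> \<eta> x \<le> 1) \<and>
     (AE z in P. real_cond_exp P (vimage_algebra (space P) fst borel)
                   (\<lambda>w. of_bool (snd w)) z = \<eta> (fst z)) \<and>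
     (\<forall>x. x \<notin> measure_support (X_marginal P) \<longrightarrow> \<eta> x = 1/2)"

definition bayes_classifier :: "(real ^ 'd \<Rightarrow> real) \<Rightarrow> real ^ 'd \<Rightarrow> bool" where
  "bayes_classifier \<eta> x \<longleftrightarrow> \<not> \<eta> x \<le> 1/2"

definition risk :: "((real ^ 'd) \<times> bool) measure \<Rightarrow> (real ^ 'd \<Rightarrow> bool) \<Rightarrow> real" where
  "risk Q f = \<P>(z in Q. snd z \<noteq> f (fst z))"

definition excess_risk ::
    "((real ^ 'd) \<times> bool) measure \<Rightarrow> (real ^ 'd \<Rightarrow> real) \<Rightarrow> (real ^ 'd \<Rightarrow> bool) \<Rightarrow> real" where
  "excess_risk Q \<eta>Q f = risk Q f - risk Q (bayes_classifier \<eta>Q)"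

definition relative_signal_exponent ::
    "((real ^ 'd) \<times> bool) measure \<Rightarrow> ((real ^ 'd) \<times> bool) measure \<Rightarrow>
     (real ^ 'd \<Rightarrow> real) \<Rightarrow> (real ^ 'd \<Rightarrow> real) \<Rightarrow> real \<Rightarrow> real \<Rightarrow> bool" where
  "relative_signal_exponent P Q \<eta>P \<eta>Q \<gamma> C\<gamma> \<longleftrightarrow>
     (\<forall>x \<in> measure_support (X_marginal P) \<union> measure_support (X_marginal Q).
        (\<eta>P x - 1/2) * (\<eta>Q x - 1/2) \<ge> 0 \<and>
        \<bar>\<eta>P x - 1/2\<bar> \<ge> C\<gamma> * \<bar>\<eta>Q x - 1/2\<bar> powr \<gamma>)"

definition margin_condition ::
    "((real ^ 'd) \<times> bool) measure \<Rightarrow> (real ^ 'd \<Rightarrow> real) \<Rightarrow> real \<Rightarrow> real \<Rightarrow> bool" where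
  "margin_condition Q \<eta>Q \<alpha> C\<alpha> \<longleftrightarrow>
     (\<forall>t>0. \<P>(x in X_marginal Q. 0 < \<bar>\<eta>Q x - 1/2\<bar> \<and> \<bar>\<eta>Q x - 1/2\<bar> < t) \<le> C\<alpha> * t powr \<alpha>)"

definition smoothness ::
    "((real ^ 'd) \<times> bool) measure \<Rightarrow> (real ^ 'd \<Rightarrow> real) \<Rightarrow> real \<Rightarrow> real \<Rightarrow> bool" where
  "smoothness Q \<eta>Q \<beta> C\<beta> \<longleftrightarrow>
     (\<forall>x1 \<in> measure_support (X_marginal Q). \<forall>x2 \<in> measure_support (X_marginal Q).
        \<bar>\<eta>Q x1 - \<eta>Q x2\<bar> \<le> C\<beta> * norm (x1 - x2) powr \<beta>)"

text \<open>
  The density bounds are required of some version of the Radon-Nikodym density of the marginal;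
  its existence subsumes absolute continuity.
\<close>

definition density_between ::
    "((real ^ 'd) \<times> bool) measure \<Rightarrow> real \<Rightarrow> real \<Rightarrow> bool" where
  "density_between P a b \<longleftrightarrow>
     (\<exists>p. distributed P lborel fst p \<and>
          (\<forall>x \<in> measure_support (X_marginal P). ennreal a < p x \<and> p x < ennreal b))"

definition common_support_strong_density ::
    "((real ^ 'd) \<times> bool) measure \<Rightarrow> ((real ^ 'd) \<times> bool) measure \<Rightarrow>
     real \<Rightarrow> real \<Rightarrow> real \<Rightarrow> real \<Rightarrow> bool" where
  "common_support_strong_density P Q \<mu>m \<mu>p c\<mu> r\<mu> \<longleftrightarrow>
     (let \<Omega> = measure_support (X_marginal P) in
        \<Omega> = measure_support (X_marginal Q) \<and>
        (\<forall>x \<in> \<Omega>. \<forall>r. 0 < r \<and> r \<le> r\<mu> \<longrightarrow>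
           measure lborel (\<Omega> \<inter> ball x r) \<ge> c\<mu> * measure lborel (ball x r)) \<and>
        density_between P \<mu>m \<mu>p \<and> density_between Q \<mu>m \<mu>p)"

text \<open>
  An element of the parameter space is a pair \<open>(P, Q)\<close> together with the versions of the two
  regression functions that witness its membership.  The excess risk does not depend on the
  version of \<open>\<eta>Q\<close>, so a supremum over these quadruples is the supremum over the pairs
  \<open>(P, Q)\<close> for which suitable versions exist.
\<close>

definition param_space ::
    "real \<Rightarrow> real \<Rightarrow> real \<Rightarrow> real \<Rightarrow> real \<Rightarrow> real \<Rightarrow> real \<Rightarrow> real \<Rightarrow> real \<Rightarrow> real \<Rightarrow>
     (((real ^ 'd) \<times> bool) measure \<times> ((real ^ 'd) \<times> bool) measure \<times>
      (real ^ 'd \<Rightarrow> real) \<times> (real ^ 'd \<Rightarrow> real)) set" where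
  "param_space \<alpha> C\<alpha> \<beta> C\<beta> \<gamma> C\<gamma> \<mu>m \<mu>p c\<mu> r\<mu> =
     {(P, Q, \<eta>P, \<eta>Q).
        labelled_distribution P \<and> labelled_distribution Q \<and>
        regression_function P \<eta>P \<and> regression_function Q \<eta>Q \<and>
        relative_signal_exponent P Q \<eta>P \<eta>Q \<gamma> C\<gamma> \<and>
        margin_condition Q \<eta>Q \<alpha> C\<alpha> \<and>
        smoothness Q \<eta>Q \<beta> C\<beta> \<and>
        common_support_strong_density P Q \<mu>m \<mu>p c\<mu> r\<mu>}"

text \<open>
  A sample of size \<open>n\<close> is a function on \<open>{..<n}\<close>.  Neighbours are counted from 0, so the
  \<open>i\<close>-th nearest one is \<open>nearest D n x (i - 1)\<close>.  The sort is stable: points at equal distance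
  are ordered by their index in the sample.
\<close>

definition nearest ::
    "(nat \<Rightarrow> (real ^ 'd) \<times> bool) \<Rightarrow> nat \<Rightarrow> real ^ 'd \<Rightarrow> nat \<Rightarrow> (real ^ 'd) \<times> bool" where
  "nearest D n x i = D (sort_key (\<lambda>j. dist x (fst (D j))) [0..<n] ! i)"

definition eta_NN ::
    "nat \<Rightarrow> nat \<Rightarrow> real \<Rightarrow> real \<Rightarrow> nat \<Rightarrow> nat \<Rightarrow>
     (nat \<Rightarrow> (real ^ 'd) \<times> bool) \<Rightarrow> (nat \<Rightarrow> (real ^ 'd) \<times> bool) \<Rightarrow> real ^ 'd \<Rightarrow> real" where
  "eta_NN nP nQ wP wQ kP kQ DP DQ x =
     (if kP = 0 \<and> kQ = 0 then 1/2
      else (wP * (\<Sum>i<kP. of_bool (snd (nearest DP nP x i)))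
            + wQ * (\<Sum>i<kQ. of_bool (snd (nearest DQ nQ x i))))
           / (wP * real kP + wQ * real kQ))"

definition classifier_NN ::
    "nat \<Rightarrow> nat \<Rightarrow> real \<Rightarrow> real \<Rightarrow> nat \<Rightarrow> nat \<Rightarrow>
     (nat \<Rightarrow> (real ^ 'd) \<times> bool) \<Rightarrow> (nat \<Rightarrow> (real ^ 'd) \<times> bool) \<Rightarrow> real ^ 'd \<Rightarrow> bool" where
  "classifier_NN nP nQ wP wQ kP kQ DP DQ x \<longleftrightarrow> eta_NN nP nQ wP wQ kP kQ DP DQ x > 1/2"

definition data_distribution ::
    "((real ^ 'd) \<times> bool) measure \<Rightarrow> nat \<Rightarrow> ((real ^ 'd) \<times> bool) measure \<Rightarrow> nat \<Rightarrow>
     ((nat \<Rightarrow> (real ^ 'd) \<times> bool) \<times> (nat \<Rightarrow> (real ^ 'd) \<times> bool)) measure" where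
  "data_distribution P nP Q nQ = PiM {..<nP} (\<lambda>_. P) \<Otimes>\<^sub>M PiM {..<nQ} (\<lambda>_. Q)"

definition expected_excess_risk_NN ::
    "nat \<Rightarrow> nat \<Rightarrow> real \<Rightarrow> real \<Rightarrow> nat \<Rightarrow> nat \<Rightarrow>
     ((real ^ 'd) \<times> bool) measure \<Rightarrow> ((real ^ 'd) \<times> bool) measure \<Rightarrow> (real ^ 'd \<Rightarrow> real) \<Rightarrow> real" where
  "expected_excess_risk_NN nP nQ wP wQ kP kQ P Q \<eta>Q =
     (\<integral>D. excess_risk Q \<eta>Q (classifier_NN nP nQ wP wQ kP kQ (fst D) (snd D))
        \<partial>(data_distribution P nP Q nQ))"

end

theory Submission
  imports Defs
begin

text \<open>
  Write \<open>\<delta> = N powr (-\<beta> / (2\<beta> + d))\<close>, so that \<open>wQ = \<delta>\<close>, \<open>wP = \<delta> powr \<gamma>\<close> and the claimed rate is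
  \<open>\<delta> powr (1 + \<alpha>)\<close>.  Fix a test point \<open>x\<close> with distance \<open>\<Delta> = \<bar>\<eta>Q x - 1/2\<bar>\<close> from the decision
  boundary and let \<open>b\<close> be the Bayes label there.  A wrong answer of the classifier forces the
  weighted number of votes for \<open>b\<close>, centred at one half per vote, to be nonpositive.  The proof
  bounds the exponential moment of that vote.

  Conditionally on the covariates the labels of the neighbours are independent, because the
  ranking of the sample depends on the covariates only (\<open>nn_integral_nearest_labels\<close>).  The
  neighbours lie within distance \<open>r = R * N powr (-1 / (2\<beta> + d))\<close> of \<open>x\<close> unless a ball of mass of
  order \<open>r ^ d\<close> catches fewer than \<open>k\<close> points.  By smoothness, neighbours in that ball have a bias
  at least \<open>\<Delta> / 2\<close> towards \<open>b\<close> in the \<open>Q\<close>-sample as soon as \<open>\<Delta>\<close> is a large multiple of \<open>\<delta>\<close>, hence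
  a bias at least \<open>C\<gamma> * (\<Delta> / 2) powr \<gamma>\<close> in the \<open>P\<close>-sample.  The number \<open>k\<close> of neighbours may be
  small, so the exceptional event need not be rare in absolute terms.  What helps is that its
  probability is at most \<open>exp (-A * k)\<close> with \<open>A\<close> as large as desired when \<open>R\<close> is large, while the
  vote of \<open>k\<close> misleading neighbours contributes at most \<open>exp (u * k / 2)\<close> to the exponential
  moment.  So the exceptional event costs only a factor 2 (\<open>nearest_votes_mgf\<close>), uniformly in \<open>k\<close>,
  and no case distinction on the sample sizes arises.

  With \<open>t = \<Delta> / \<delta>\<close> the two samples combine to an error probability of at most
  \<open>4 * exp (-c * S * t powr (2 * min 1 \<gamma>))\<close> (\<open>misclassification_decay\<close>), where
  \<open>S = kP * wP\<^sup>2 + kQ * wQ\<^sup>2\<close> is an effective sample size.  The weights and neighbour numbers are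
  calibrated precisely so that \<open>S\<close> stays bounded below for large \<open>N\<close> (\<open>effective_sample_size\<close>):
  one of the two summands of \<open>N\<close> is at least \<open>N / 2\<close>, and the corresponding sample alone
  suffices.

  The excess risk is the integral of \<open>2 * \<Delta>\<close> over the misclassified points.  The error probability
  decays faster than any power of \<open>t\<close>, so summing the margin condition over the dyadic shells
  \<open>\<Delta> \<approx> 2 ^ j * \<delta>\<close> gives the order \<open>\<delta> powr (1 + \<alpha>)\<close> (\<open>nn_integral_margin_le\<close>).  For bounded \<open>N\<close>
  the trivial bound 1 on the excess risk is enough.
\<close>


section \<open>Ranking a sample by distance\<close>

text \<open>
  Sorting with respect to keys that depend measurably on \<open>\<omega>\<close> only branches on finitely many
  comparisons of keys.  The target is restricted to lists over \<open>A\<close> because the keys of other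
  indices need not be measurable.
\<close>
lemma measurable_insort_key:
  fixes f :: "'a \<Rightarrow> 'b::countable \<Rightarrow> real"
  assumes f: "\<And>j. j \<in> A \<Longrightarrow> (\<lambda>\<omega>. f \<omega> j) \<in> borel_measurable M"
    and a: "a \<in> A" and l: "set l \<subseteq> A"
  shows "(\<lambda>\<omega>. insort_key (f \<omega>) a l) \<in> measurable M (count_space (lists A))"
  using l
proof (induction l)
  case Nil
  then show ?case using a by auto
next
  case (Cons b l)
  note [measurable] = f[OF a] f[of b]
  have b: "b \<in> A" using Cons.prems by simp
  have [measurable]: "(\<lambda>\<omega>. insort_key (f \<omega>) a l) \<in> measurable M (count_space (lists A))"
    using Cons by simp
  have 1: "(\<lambda>\<omega>. b # insort_key (f \<omega>) a l) \<in> measurable M (count_space (lists A))"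
    by (rule measurable_compose[OF \<open>(\<lambda>\<omega>. insort_key (f \<omega>) a l) \<in> _\<close>]) (use b in auto)
  have 2: "(\<lambda>\<omega>. a # b # l) \<in> measurable M (count_space (lists A))"
    by (rule measurable_const) (use a Cons.prems in auto)
  have 3: "Measurable.pred M (\<lambda>\<omega>. f \<omega> a \<le> f \<omega> b)"
    using b by measurable
  show ?case
    using measurable_If[OF 2 1 3[unfolded pred_def]] by simp
qed

lemma measurable_sort_key:
  fixes f :: "'a \<Rightarrow> 'b::countable \<Rightarrow> real"
  assumes f: "\<And>j. j \<in> A \<Longrightarrow> (\<lambda>\<omega>. f \<omega> j) \<in> borel_measurable M" and xs: "set xs \<subseteq> A"
  shows "(\<lambda>\<omega>. sort_key (f \<omega>) xs) \<in> measurable M (count_space (lists A))"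
  using xs
proof (induction xs)
  case (Cons a xs)
  have "(\<lambda>\<omega>. insort_key (f \<omega>) a (sort_key (f \<omega>) xs)) \<in> measurable M (count_space (lists A))"
    by (rule measurable_compose_countable'[where I = "lists A" and f = "\<lambda>l \<omega>. insort_key (f \<omega>) a l"])
       (use Cons f in \<open>auto intro!: measurable_insort_key\<close>)
  then show ?case by simp
qed auto

text \<open>
  If at least \<open>k\<close> sample points lie within radius \<open>r\<close>, then so do the \<open>k\<close> nearest ones: otherwise
  all the points within \<open>r\<close> would be ranked before some position \<open>i < k\<close>, and there would be at most
  \<open>i\<close> of them.
\<close>
lemma sort_key_nth_less:
  fixes f :: "nat \<Rightarrow> real"
  assumes k: "k \<le> card {j. j < n \<and> f j < r}" and i: "i < k"
  shows "f (sort_key f [0..<n] ! i) < r"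
proof (rule ccontr)
  let ?s = "sort_key f [0..<n]"
  assume "\<not> f (?s ! i) < r"
  hence ge: "r \<le> f (?s ! i)" by simp
  have "card {j. j < n \<and> f j < r} \<le> card {..<n}" by (intro card_mono) auto
  hence n: "k \<le> n" using k by simp
  have sub: "{j. j < n \<and> f j < r} \<subseteq> (!) ?s ` {..<i}"
  proof
    fix j assume "j \<in> {j. j < n \<and> f j < r}"
    hence j: "j < n" "f j < r" by auto
    hence "j \<in> set ?s" by simp
    then obtain m where m: "m < n" "j = ?s ! m"
      unfolding in_set_conv_nth length_sort length_upt by auto
    have "m < i"
    proof (rule ccontr)
      assume "\<not> m < i"
      hence "map f ?s ! i \<le> map f ?s ! m"
        using m by (intro sorted_nth_mono) auto
      thus False using ge j m i n by simp
    qed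
    thus "j \<in> (!) ?s ` {..<i}" using m by blast
  qed
  have "card {j. j < n \<and> f j < r} \<le> card {..<i}"
    by (rule surj_card_le[OF _ sub]) simp
  thus False using k i by simp
qed

lemma sort_key_cong:
  assumes "\<And>j. j \<in> set xs \<Longrightarrow> f j = g j"
  shows "sort_key f xs = sort_key g xs"
proof -
  have ins: "insort_key f a l = insort_key g a l"
    if "f a = g a" "\<And>j. j \<in> set l \<Longrightarrow> f j = g j" for a l
    using that by (induction l) auto
  show ?thesis using assms
    by (induction xs) (auto intro!: ins)
qed

lemma prod_nth_take:
  assumes "distinct l" "k \<le> length l"
  shows "(\<Prod>i<k. F (l ! i)) = (\<Prod>j\<in>set (take k l). F j)"
proof -
  have "bij_betw ((!) (take k l)) {..<k} (set (take k l))"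
    using assms by (intro bij_betw_nth) auto
  from prod.reindex_bij_betw[OF this, of F] show ?thesis by simp
qed

lemma measurable_sort_key_dist:
  assumes "\<And>j. j < n \<Longrightarrow> (\<lambda>\<omega>. X \<omega> j) \<in> borel_measurable M" "f \<in> borel_measurable M"
  shows "(\<lambda>\<omega>. sort_key (\<lambda>j. dist (f \<omega>) (X \<omega> j :: real^'d)) [0..<n]) \<in> measurable M (count_space UNIV)"
proof -
  have "(\<lambda>\<omega>. sort_key (\<lambda>j. dist (f \<omega>) (X \<omega> j)) [0..<n]) \<in> measurable M (count_space (lists {..<n}))"
    by (rule measurable_sort_key[where f = "\<lambda>\<omega> j. dist (f \<omega>) (X \<omega> j)"])
       (use assms in \<open>auto intro!: borel_measurable_dist\<close>)
  thus ?thesis by (rule measurable_compose) simp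
qed

section \<open>Supports and regression functions\<close>

lemma measurable_fst_labelled [measurable]: "fst \<in> measurable (labelled_space :: ((real^'d) \<times> bool) measure) borel"
  by measurable

lemma closed_measure_support:
  fixes M :: "'a::metric_space measure"
  assumes s: "sets M = sets borel"
  shows "closed (measure_support M)"
  unfolding closed_def
proof (rule openI)
  fix x assume "x \<in> - measure_support M"
  then obtain r where r: "r > 0" "emeasure M (ball x r) = 0"
    by (auto simp: measure_support_def)
  have "ball x r \<subseteq> - measure_support M"
  proof
    fix y assume "y \<in> ball x r"
    then obtain e where e: "e > 0" "ball y e \<subseteq> ball x r"
      using open_ball open_contains_ball by blast
    hence "emeasure M (ball y e) \<le> emeasure M (ball x r)"
      by (intro emeasure_mono) (auto simp: s)
    thus "y \<in> - measure_support M"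
      using r e by (auto simp: measure_support_def not_less)
  qed
  thus "\<exists>e>0. ball x e \<subseteq> - measure_support M" using r by blast
qed

text \<open>
  The complement of the support is covered by open null sets, and by Lindelof's theorem countably
  many of them suffice.
\<close>
lemma AE_in_measure_support:
  fixes M :: "'a::{metric_space, second_countable_topology} measure"
  assumes s: "sets M = sets borel"
  shows "AE x in M. x \<in> measure_support M"
proof -
  define F where "F = {U. open U \<and> emeasure M U = 0}"
  obtain F' where F': "F' \<subseteq> F" "countable F'" "\<Union>F' = \<Union>F"
    using Lindelof[of F] unfolding F_def by blast
  have "- measure_support M \<subseteq> \<Union>F"
  proof
    fix x assume "x \<in> - measure_support M"
    then obtain r where r: "r > 0" "emeasure M (ball x r) = 0"
      by (auto simp: measure_support_def)
    thus "x \<in> \<Union>F" unfolding F_def by (intro UnionI[of "ball x r"]) auto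
  qed
  moreover have "\<Union>F' \<in> null_sets M"
    using F' by (intro null_sets_UN'[where N = id, simplified]) (auto simp: F_def null_sets_def s)
  ultimately show ?thesis
    using F'(3) by (intro AE_I'[of "\<Union>F'"]) auto
qed

text \<open>
  The definition through conditional expectations amounts to a disintegration of \<open>P\<close>: draw the
  covariate first, then a Bernoulli label with parameter \<open>\<eta>\<close>.  Testing the conditional
  expectation on preimages \<open>fst -` B\<close> shows that the two sides agree for functions of the covariate
  times an indicator of the label, because they are integrals against equal measures on the
  covariate space.
\<close>
lemma regression_function_nn_integral:
  fixes P :: "((real ^ 'd) \<times> bool) measure"
  assumes P: "prob_space P" and sets: "sets P = sets labelled_space"
    and reg: "regression_function P \<eta>"
    and f [measurable]: "f \<in> borel_measurable labelled_space"
  shows "(\<integral>\<^sup>+z. f z \<partial>P) = (\<integral>\<^sup>+z. ennreal (\<eta> (fst z)) * f (fst z, True) + ennreal (1 - \<eta> (fst z)) * f (fst z, False) \<partial>P)"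
proof -
  note [measurable_cong] = sets
  have sp: "space P = UNIV" using sets_eq_imp_space_eq[OF sets] by (simp add: space_pair_measure)
  interpret P: prob_space P by fact
  define F where "F = vimage_algebra (space P) fst (borel :: (real^'d) measure)"
  have sub: "subalgebra P F"
    unfolding subalgebra_def
  proof
    show "sets F \<subseteq> sets P" unfolding F_def
      by (rule sets_image_in_sets) auto
  qed (simp add: F_def)
  interpret F: sigma_finite_subalgebra P F
    using sub by (intro finite_measure_subalgebra_is_sigma_finite) (simp add: finite_measure_subalgebra_def finite_measure_subalgebra_axioms_def P.finite_measure_axioms)
  have [measurable]: "\<eta> \<in> borel_measurable borel" and rng: "\<And>x. 0 \<le> \<eta> x" "\<And>x. \<eta> x \<le> 1"
    and ce: "AE z in P. real_cond_exp P F (\<lambda>w. of_bool (snd w)) z = \<eta> (fst z)"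
    using reg unfolding regression_function_def F_def by auto
  have [measurable]: "(\<lambda>w. of_bool (snd w) :: real) \<in> borel_measurable P" by measurable
  have int: "integrable P (\<lambda>w. of_bool (snd w) :: real)"
    by (rule P.integrable_const_bound[where B = 1]) auto
  have int2: "integrable P (\<lambda>z. \<eta> (fst z))"
    by (rule P.integrable_const_bound[where B = 1]) (use rng in auto)
  have eq: "(LINT w:fst -` B|P. of_bool (snd w)) = (LINT w:fst -` B|P. \<eta> (fst w))"
    if B[measurable]: "B \<in> sets borel" for B
  proof -
    have A: "fst -` B \<in> sets F" unfolding F_def using in_vimage_algebra[OF B, of fst "space P"] by (simp add: sp)
    hence [measurable]: "fst -` B \<in> sets P" using sub unfolding subalgebra_def by auto
    show ?thesis
      apply (subst F.real_cond_exp_intA[OF int A])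
      apply (rule set_lebesgue_integral_cong_AE) using ce by auto
  qed
  \<comment> \<open>The two cases for the label differ only in the pair of functions with equal integrals.\<close>
  have gen: "(\<integral>\<^sup>+z. ennreal (\<phi> z) * u (fst z) \<partial>P) = (\<integral>\<^sup>+z. ennreal (\<psi> z) * u (fst z) \<partial>P)"
    if i: "integrable P \<phi>" "integrable P \<psi>" and nn: "\<And>z. 0 \<le> \<phi> z" "\<And>z. 0 \<le> \<psi> z"
      and e: "\<And>B. B \<in> sets borel \<Longrightarrow> (LINT w:fst -` B|P. \<phi> w) = (LINT w:fst -` B|P. \<psi> w)"
      and u [measurable]: "u \<in> borel_measurable borel"
    for \<phi> \<psi> :: "_ \<Rightarrow> real" and u :: "_ \<Rightarrow> ennreal"
  proof -
    define M where "M \<phi> = distr (density P (\<lambda>z. ennreal (\<phi> z))) borel (fst :: (real^'d)\<times>bool \<Rightarrow> _)"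
      for \<phi> :: "_ \<Rightarrow> real"
    have [measurable]: "\<phi> \<in> borel_measurable P" "\<psi> \<in> borel_measurable P" using i by auto
    have em: "emeasure (M \<phi>) B = ennreal (LINT w:fst -` B|P. \<phi> w)"
      if B[measurable]: "B \<in> sets borel" and i: "integrable P \<phi>" and nn: "\<And>z. 0 \<le> \<phi> z" for B \<phi>
    proof -
      have [measurable]: "\<phi> \<in> borel_measurable P" using i by auto
      have [measurable]: "fst -` B \<in> sets P" using measurable_sets[OF measurable_fst_labelled B]
        by (simp add: sets space_pair_measure)
      have "emeasure (M \<phi>) B = (\<integral>\<^sup>+z. ennreal (indicator (fst -` B) z * \<phi> z) \<partial>P)"
        unfolding M_def by (subst emeasure_distr, simp, simp, subst emeasure_density)
          (auto simp: sp indicator_def intro!: nn_integral_cong)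
      also have "\<dots> = ennreal (LINT w:fst -` B|P. \<phi> w)"
        unfolding set_lebesgue_integral_def using integrable_mult_indicator[OF _ i, of "fst -` B"] nn
        by (subst nn_integral_eq_integral) auto
      finally show ?thesis .
    qed
    have "M \<phi> = M \<psi>"
    proof (rule measure_eqI)
      show "sets (M \<phi>) = sets (M \<psi>)" by (simp add: M_def)
      fix B assume "B \<in> sets (M \<phi>)"
      hence B: "B \<in> sets borel" by (simp add: M_def)
      show "emeasure (M \<phi>) B = emeasure (M \<psi>) B"
        using em[OF B] i nn e[OF B] by simp
    qed
    have "(\<integral>\<^sup>+x. u x \<partial>M \<phi>) = (\<integral>\<^sup>+z. ennreal (\<phi> z) * u (fst z) \<partial>P)"
      if [measurable]: "\<phi> \<in> borel_measurable P" for \<phi>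
      unfolding M_def by (subst nn_integral_distr, simp, simp, subst nn_integral_density) auto
    from this[OF \<open>\<phi> \<in> borel_measurable P\<close>] this[OF \<open>\<psi> \<in> borel_measurable P\<close>] \<open>M \<phi> = M \<psi>\<close>
    show ?thesis by simp
  qed
  have key: "(\<integral>\<^sup>+z. of_bool (snd z) * u (fst z) \<partial>P) = (\<integral>\<^sup>+z. ennreal (\<eta> (fst z)) * u (fst z) \<partial>P)"
    if u: "u \<in> borel_measurable borel" for u :: "_ \<Rightarrow> ennreal"
    using gen[OF int int2 _ _ eq u] rng by (simp add: of_bool_def if_distrib[of ennreal] cong: if_cong)
  have key0: "(\<integral>\<^sup>+z. of_bool (\<not> snd z) * u (fst z) \<partial>P) = (\<integral>\<^sup>+z. ennreal (1 - \<eta> (fst z)) * u (fst z) \<partial>P)"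
    if u: "u \<in> borel_measurable borel" for u :: "_ \<Rightarrow> ennreal"
  proof -
    have "(\<integral>\<^sup>+z. ennreal (1 - of_bool (snd z)) * u (fst z) \<partial>P) = (\<integral>\<^sup>+z. ennreal (1 - \<eta> (fst z)) * u (fst z) \<partial>P)"
    proof (rule gen[OF _ _ _ _ _ u])
      fix B :: "(real^'d) set" assume B[measurable]: "B \<in> sets borel"
      have m: "fst -` B \<in> sets P" using measurable_sets[OF measurable_fst_labelled B]
        by (simp add: sets space_pair_measure)
      have "set_integrable P (fst -` B) (\<lambda>w. of_bool (snd w) :: real)" "set_integrable P (fst -` B) (\<lambda>w. \<eta> (fst w))"
        "set_integrable P (fst -` B) (\<lambda>w. 1 :: real)"
        unfolding set_integrable_def by (intro integrable_mult_indicator m int int2 P.integrable_const)+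
      thus "(LINT w:fst -` B|P. 1 - of_bool (snd w)) = (LINT w:fst -` B|P. 1 - \<eta> (fst w))"
        by (simp add: set_integral_diff eq[OF B])
    qed (use rng int int2 in auto)
    also have "(\<integral>\<^sup>+z. ennreal (1 - of_bool (snd z)) * u (fst z) \<partial>P) = (\<integral>\<^sup>+z. of_bool (\<not> snd z) * u (fst z) \<partial>P)"
      by (intro nn_integral_cong) auto
    finally show ?thesis .
  qed
  have "(\<integral>\<^sup>+z. f z \<partial>P) = (\<integral>\<^sup>+z. of_bool (snd z) * f (fst z, True) + of_bool (\<not> snd z) * f (fst z, False) \<partial>P)"
  proof (rule nn_integral_cong)
    fix z :: "(real^'d) \<times> bool"
    show "f z = of_bool (snd z) * f (fst z, True) + of_bool (\<not> snd z) * f (fst z, False)"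
      by (cases z; cases "snd z") auto
  qed
  also have "\<dots> = (\<integral>\<^sup>+z. of_bool (snd z) * f (fst z, True) \<partial>P) + (\<integral>\<^sup>+z. of_bool (\<not> snd z) * f (fst z, False) \<partial>P)"
    by (rule nn_integral_add) measurable
  also have "\<dots> = (\<integral>\<^sup>+z. ennreal (\<eta> (fst z)) * f (fst z, True) \<partial>P) + (\<integral>\<^sup>+z. ennreal (1 - \<eta> (fst z)) * f (fst z, False) \<partial>P)"
    by (subst key, measurable, subst key0, measurable)
  also have "\<dots> = (\<integral>\<^sup>+z. ennreal (\<eta> (fst z)) * f (fst z, True) + ennreal (1 - \<eta> (fst z)) * f (fst z, False) \<partial>P)"
    by (rule nn_integral_add[symmetric]) measurable
  finally show ?thesis .
qed

section \<open>Votes of the nearest neighbours\<close>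

text \<open>
  Conditional independence of the labels given the covariates, in integrated form: for one
  observation the label may be averaged out against \<open>\<eta>1\<close>, \<open>\<eta>0\<close>, and for an i.i.d. sample this can
  be done one coordinate after the other.  The factor \<open>h\<close> is an arbitrary function of all
  covariates, which is what makes the induction go through: integrating out one observation turns
  \<open>h\<close> into another function \<open>h'\<close> of the remaining covariates.
\<close>
lemma nn_integral_PiM_integrate_labels:
  fixes P :: "((real ^ 'd) \<times> bool) measure" and \<eta>1 \<eta>0 :: "real ^ 'd \<Rightarrow> ennreal" and J :: "'i set"
  assumes P: "prob_space P" and sets: "sets P = sets labelled_space"
    and dis: "\<And>f. f \<in> borel_measurable labelled_space \<Longrightarrow>
       (\<integral>\<^sup>+z. f z \<partial>P) = (\<integral>\<^sup>+z. \<eta>1 (fst z) * f (fst z, True) + \<eta>0 (fst z) * f (fst z, False) \<partial>P)"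
    and [measurable]: "\<eta>1 \<in> borel_measurable borel" "\<eta>0 \<in> borel_measurable borel"
    and "finite J" and "h \<in> borel_measurable (PiM J (\<lambda>_. borel))"
  shows "(\<integral>\<^sup>+D. h (\<lambda>j\<in>J. fst (D j)) * (\<Prod>j\<in>J. g j (snd (D j))) \<partial>PiM J (\<lambda>_. P)) =
         (\<integral>\<^sup>+D. h (\<lambda>j\<in>J. fst (D j)) *
            (\<Prod>j\<in>J. \<eta>1 (fst (D j)) * g j True + \<eta>0 (fst (D j)) * g j False) \<partial>PiM J (\<lambda>_. P))"
  using \<open>finite J\<close> \<open>h \<in> _\<close>
proof (induction J arbitrary: h rule: finite_induct)
  case empty
  show ?case by simp
next
  case (insert i J)
  note [measurable] = insert.prems and [measurable_cong] = sets
  interpret P: prob_space P by fact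
  interpret product_sigma_finite "\<lambda>_. P" by unfold_locales
  let ?m = "\<lambda>j x. \<eta>1 x * g j True + \<eta>0 x * g j False"
  define h' where "h' X = (\<integral>\<^sup>+y. h (X(i := fst y)) * ?m i (fst y) \<partial>P)" for X
  have upd[measurable]: "(\<lambda>(X, y). X(i := fst y)) \<in>
     measurable (PiM J (\<lambda>_. borel) \<Otimes>\<^sub>M labelled_space) (PiM (insert i J) (\<lambda>_. borel :: (real^'d) measure))"
    unfolding split_beta by (rule measurable_fun_upd[where J = J]) (use insert in auto)
  have "(\<lambda>(X, y). h (X(i := fst y)) * ?m i (fst y)) \<in> borel_measurable (PiM J (\<lambda>_. borel) \<Otimes>\<^sub>M labelled_space)"
    using measurable_compose[OF upd insert.prems] by (simp add: split_beta)
  hence h'[measurable]: "h' \<in> borel_measurable (PiM J (\<lambda>_. borel))"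
    unfolding h'_def by measurable
  have hJ: "h (\<lambda>j\<in>insert i J. fst ((D(i := y)) j)) = h ((\<lambda>j\<in>J. fst (D j))(i := fst y))" for D y
    using insert by (intro arg_cong[where f = h]) auto
  have prJ: "(\<Prod>j\<in>insert i J. F j ((D(i := y)) j)) = F i y * (\<Prod>j\<in>J. F j (D j))" 
    for F :: "'i \<Rightarrow> (real^'d) \<times> bool \<Rightarrow> ennreal" and D y
  proof -
    have "(\<Prod>j\<in>J. F j ((D(i := y)) j)) = (\<Prod>j\<in>J. F j (D j))"
      by (rule prod.cong) (use insert.hyps in auto)
    thus ?thesis using insert.hyps by simp
  qed
  have meas1: "(\<lambda>y. h ((\<lambda>j\<in>J. fst (D j))(i := fst y))) \<in> borel_measurable labelled_space" for D :: "'i \<Rightarrow> (real^'d) \<times> bool"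
  proof -
    have "(\<lambda>j\<in>J. fst (D j)) \<in> space (PiM J (\<lambda>_. borel))" by (auto simp: space_PiM)
    from measurable_compose[OF measurable_Pair1'[OF this] measurable_compose[OF upd insert.prems]]
    show ?thesis by simp
  qed
  have "(\<integral>\<^sup>+D. h (\<lambda>j\<in>insert i J. fst (D j)) * (\<Prod>j\<in>insert i J. g j (snd (D j))) \<partial>PiM (insert i J) (\<lambda>_. P)) =
     (\<integral>\<^sup>+D. (\<integral>\<^sup>+y. h ((\<lambda>j\<in>J. fst (D j))(i := fst y)) * (g i (snd y) * (\<Prod>j\<in>J. g j (snd (D j)))) \<partial>P) \<partial>PiM J (\<lambda>_. P))"
    apply (subst product_nn_integral_insert)
    using insert.hyps apply (simp_all only: hJ prJ[of "\<lambda>j z. g j (snd z)"])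
    by measurable
  also have "\<dots> = (\<integral>\<^sup>+D. h' (\<lambda>j\<in>J. fst (D j)) * (\<Prod>j\<in>J. g j (snd (D j))) \<partial>PiM J (\<lambda>_. P))"
  proof (rule nn_integral_cong)
    fix D :: "'i \<Rightarrow> (real^'d) \<times> bool"
    note [measurable] = meas1[of D]
    have "(\<integral>\<^sup>+y. h ((\<lambda>j\<in>J. fst (D j))(i := fst y)) * (g i (snd y) * (\<Prod>j\<in>J. g j (snd (D j)))) \<partial>P)
       = (\<integral>\<^sup>+y. h ((\<lambda>j\<in>J. fst (D j))(i := fst y)) * g i (snd y) \<partial>P) * (\<Prod>j\<in>J. g j (snd (D j)))"
      by (subst nn_integral_multc[symmetric]) (auto simp: mult_ac)
    also have "(\<integral>\<^sup>+y. h ((\<lambda>j\<in>J. fst (D j))(i := fst y)) * g i (snd y) \<partial>P) = h' (\<lambda>j\<in>J. fst (D j))"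
      unfolding h'_def by (subst dis) (auto simp: algebra_simps)
    finally show "(\<integral>\<^sup>+y. h ((\<lambda>j\<in>J. fst (D j))(i := fst y)) * (g i (snd y) * (\<Prod>j\<in>J. g j (snd (D j)))) \<partial>P)
      = h' (\<lambda>j\<in>J. fst (D j)) * (\<Prod>j\<in>J. g j (snd (D j)))" .
  qed
  also have "\<dots> = (\<integral>\<^sup>+D. h' (\<lambda>j\<in>J. fst (D j)) * (\<Prod>j\<in>J. ?m j (fst (D j))) \<partial>PiM J (\<lambda>_. P))"
    by (rule insert.IH) measurable
  also have "\<dots> = (\<integral>\<^sup>+D. (\<integral>\<^sup>+y. h ((\<lambda>j\<in>J. fst (D j))(i := fst y)) * (?m i (fst y) * (\<Prod>j\<in>J. ?m j (fst (D j)))) \<partial>P) \<partial>PiM J (\<lambda>_. P))"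
  proof (rule nn_integral_cong)
    fix D :: "'i \<Rightarrow> (real^'d) \<times> bool"
    note [measurable] = meas1[of D]
    show "h' (\<lambda>j\<in>J. fst (D j)) * (\<Prod>j\<in>J. ?m j (fst (D j))) =
       (\<integral>\<^sup>+y. h ((\<lambda>j\<in>J. fst (D j))(i := fst y)) * (?m i (fst y) * (\<Prod>j\<in>J. ?m j (fst (D j)))) \<partial>P)"
      unfolding h'_def by (subst nn_integral_multc[symmetric]) (auto simp: mult_ac)
  qed
  also have "\<dots> = (\<integral>\<^sup>+D. h (\<lambda>j\<in>insert i J. fst (D j)) * (\<Prod>j\<in>insert i J. ?m j (fst (D j))) \<partial>PiM (insert i J) (\<lambda>_. P))"
    apply (subst product_nn_integral_insert)
    using insert.hyps apply (simp_all only: hJ prJ[of "\<lambda>j z. ?m j (fst z)"])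
    by measurable
  finally show ?case .
qed

text \<open>
  The labels of the \<open>k\<close> nearest neighbours are averaged out by splitting according to the value \<open>l\<close>
  of the ranking.  That value depends on the covariates alone, so on each of the finitely many
  parts the neighbours have fixed indices and the previous result for i.i.d. labels applies.
\<close>
lemma nn_integral_nearest_labels:
  fixes P :: "((real ^ 'd) \<times> bool) measure"
  assumes P: "prob_space P" and sets: "sets P = sets labelled_space"
    and reg: "regression_function P \<eta>" and k: "k \<le> n"
  shows "(\<integral>\<^sup>+D. (\<Prod>i<k. G (snd (nearest D n x i))) \<partial>PiM {..<n} (\<lambda>_. P)) =
         (\<integral>\<^sup>+D. (\<Prod>i<k. ennreal (\<eta> (fst (nearest D n x i))) * G True +
                        ennreal (1 - \<eta> (fst (nearest D n x i))) * G False) \<partial>PiM {..<n} (\<lambda>_. P))"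
proof -
  note [measurable_cong] = sets
  have [measurable]: "\<eta> \<in> borel_measurable borel" and rng: "\<And>x. 0 \<le> \<eta> x" "\<And>x. \<eta> x \<le> 1"
    using reg unfolding regression_function_def by auto
  define m where "m x' = ennreal (\<eta> x') * G True + ennreal (1 - \<eta> x') * G False" for x'
  define s where "s X = sort_key (\<lambda>j. dist x (X j)) [0..<n]" for X :: "nat \<Rightarrow> real^'d"
  define L where "L = {l :: nat list. length l = n \<and> distinct l \<and> set l \<subseteq> {..<n}}"
  have finL: "finite L"
    unfolding L_def by (rule finite_subset[OF _ finite_lists_length_eq[of "{..<n}" n]]) auto
  have sL: "s X \<in> L" for X unfolding s_def L_def by auto
  have s_meas[measurable]: "s \<in> measurable (PiM {..<n} (\<lambda>_. borel)) (count_space UNIV)"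
    unfolding s_def by (rule measurable_sort_key_dist) auto
  have s_res: "s (\<lambda>j\<in>{..<n}. fst (D j)) = sort_key (\<lambda>j. dist x (fst (D j))) [0..<n]" for D :: "nat \<Rightarrow> (real^'d) \<times> bool"
    unfolding s_def by (rule sort_key_cong) auto
  define h where "h l X = (of_bool (s X = l) :: ennreal)" for l X
  have h[measurable]: "h l \<in> borel_measurable (PiM {..<n} (\<lambda>_. borel))" for l
    unfolding h_def by measurable
  define g where "g l j y = (if j \<in> set (take k l) then G y else 1)" for l :: "nat list" and j y
  \<comment> \<open>Neighbours are selected by a factor 1 at every index that is not among the first \<open>k\<close> of \<open>l\<close>.\<close>
  have dec: "(\<Prod>i<k. F (nearest D n x i)) =
      (\<Sum>l\<in>L. h l (\<lambda>j\<in>{..<n}. fst (D j)) * (\<Prod>j<n. if j \<in> set (take k l) then F (D j) else 1))"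
    for F :: "(real^'d) \<times> bool \<Rightarrow> ennreal" and D
  proof -
    let ?l = "s (\<lambda>j\<in>{..<n}. fst (D j))"
    have "(\<Prod>i<k. F (nearest D n x i)) = (\<Prod>j\<in>set (take k ?l). F (D j))"
      unfolding nearest_def s_res[symmetric]
      using sL[of "\<lambda>j\<in>{..<n}. fst (D j)"] k by (intro prod_nth_take) (auto simp: L_def)
    also have "\<dots> = (\<Prod>j\<in>{..<n} \<inter> set (take k ?l). F (D j))"
      using sL[of "\<lambda>j\<in>{..<n}. fst (D j)"] set_take_subset[of k ?l] by (intro prod.cong) (auto simp: L_def)
    also have "\<dots> = (\<Prod>j<n. if j \<in> set (take k ?l) then F (D j) else 1)"
      by (rule prod.inter_restrict) simp
    also have "\<dots> = (\<Sum>l\<in>L. if ?l = l then (\<Prod>j<n. if j \<in> set (take k l) then F (D j) else 1) else 0)"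
      using sL[of "\<lambda>j\<in>{..<n}. fst (D j)"] by (simp add: sum.delta'[OF finL])
    also have "\<dots> = (\<Sum>l\<in>L. h l (\<lambda>j\<in>{..<n}. fst (D j)) * (\<Prod>j<n. if j \<in> set (take k l) then F (D j) else 1))"
      unfolding h_def by (intro sum.cong) auto
    finally show ?thesis .
  qed
  have res[measurable]: "(\<lambda>D. \<lambda>j\<in>{..<n}. fst (D j)) \<in> measurable (PiM {..<n} (\<lambda>_. P)) (PiM {..<n} (\<lambda>_. borel :: (real^'d) measure))"
    by measurable
  have one: "ennreal (\<eta> y) + ennreal (1 - \<eta> y) = 1" for y
    using rng by (simp flip: ennreal_plus)
  have "(\<integral>\<^sup>+D. (\<Prod>i<k. G (snd (nearest D n x i))) \<partial>PiM {..<n} (\<lambda>_. P)) =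
     (\<integral>\<^sup>+D. (\<Sum>l\<in>L. h l (\<lambda>j\<in>{..<n}. fst (D j)) * (\<Prod>j<n. g l j (snd (D j)))) \<partial>PiM {..<n} (\<lambda>_. P))"
    unfolding dec[of "\<lambda>z. G (snd z)"] g_def ..
  also have "\<dots> = (\<Sum>l\<in>L. \<integral>\<^sup>+D. h l (\<lambda>j\<in>{..<n}. fst (D j)) * (\<Prod>j<n. g l j (snd (D j))) \<partial>PiM {..<n} (\<lambda>_. P))"
    by (rule nn_integral_sum) measurable
  also have "\<dots> = (\<Sum>l\<in>L. \<integral>\<^sup>+D. h l (\<lambda>j\<in>{..<n}. fst (D j)) *
     (\<Prod>j<n. ennreal (\<eta> (fst (D j))) * g l j True + ennreal (1 - \<eta> (fst (D j))) * g l j False) \<partial>PiM {..<n} (\<lambda>_. P))"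
    by (intro sum.cong refl nn_integral_PiM_integrate_labels[OF P sets]
              regression_function_nn_integral[OF P sets reg]) auto
  also have "\<dots> = (\<Sum>l\<in>L. \<integral>\<^sup>+D. h l (\<lambda>j\<in>{..<n}. fst (D j)) *
     (\<Prod>j<n. if j \<in> set (take k l) then m (fst (D j)) else 1) \<partial>PiM {..<n} (\<lambda>_. P))"
    by (intro sum.cong nn_integral_cong arg_cong2[where f = "(*)"] prod.cong refl)
       (auto simp: g_def m_def one)
  also have "\<dots> = (\<integral>\<^sup>+D. (\<Sum>l\<in>L. h l (\<lambda>j\<in>{..<n}. fst (D j)) *
     (\<Prod>j<n. if j \<in> set (take k l) then m (fst (D j)) else 1)) \<partial>PiM {..<n} (\<lambda>_. P))"
    unfolding m_def by (rule nn_integral_sum[symmetric]) measurable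
  also have "\<dots> = (\<integral>\<^sup>+D. (\<Prod>i<k. m (fst (nearest D n x i))) \<partial>PiM {..<n} (\<lambda>_. P))"
    unfolding dec[of "\<lambda>z. m (fst z)"] ..
  finally show ?thesis unfolding m_def .
qed

text \<open>
  Hoeffding's bound for a centred \<open>{-1/2, 1/2}\<close>-valued vote that is correct with probability \<open>q\<close>.
\<close>
lemma bernoulli_mgf_le:
  fixes q a u :: real
  assumes "u \<ge> 0" "1/2 + a \<le> q" "q \<le> 1"
  shows "q * exp (- (u / 2)) + (1 - q) * exp (u / 2) \<le> exp (- u * a + u\<^sup>2 / 8)"
proof -
  have pos: "1 + (1 - q) * (exp u - 1) > 0"
    using assms by (intro add_pos_nonneg mult_nonneg_nonneg) auto
  have "exp (u / 2) = exp (-(u / 2)) * exp u" by (simp flip: exp_add)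
  hence "q * exp (- (u / 2)) + (1 - q) * exp (u / 2) = exp (-(u/2)) * (1 + (1 - q) * (exp u - 1))"
    by (simp only:) (simp add: algebra_simps)
  also have "1 + (1 - q) * (exp u - 1) = exp (ln (1 + (1 - q) * (exp u - 1)))" using pos by simp
  also have "\<dots> \<le> exp (u * (1 - q) + u\<^sup>2 / 8)"
    using Hoeffdings_lemma_aux[of u "1 - q"] assms by simp
  also have "exp (-(u/2)) * exp (u * (1 - q) + u\<^sup>2 / 8) = exp (- u * (q - 1/2) + u\<^sup>2 / 8)"
    by (simp flip: exp_add add: algebra_simps)
  also have "\<dots> \<le> exp (- u * a + u\<^sup>2 / 8)"
    using assms mult_left_mono[of a "q - 1/2" u] by simp
  finally show ?thesis by simp
qed

text \<open>
  The bound is uniform in \<open>k\<close> because the rare event is paid for inside the exponential moment.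
  On the event that the ball of radius \<open>r\<close> contains at least \<open>k\<close> points, Hoeffding's bound holds for
  each vote.  On the complementary event each vote costs at most \<open>exp (u / 2)\<close>, while the Chernoff
  factor \<open>exp (k - #points in the ball)\<close> dominates the indicator of the event.  Because the ball has
  expected content at least \<open>2 * (1 + u) * k\<close>, this second contribution is at most
  \<open>exp (- k * u / 2)\<close>, which is below the first one as \<open>a \<le> 1/2\<close>.
\<close>
lemma nearest_votes_mgf:
  fixes P :: "((real ^ 'd) \<times> bool) measure" and x :: "real ^ 'd"
  assumes P: "prob_space P" and sets: "sets P = sets labelled_space"
    and reg: "regression_function P \<eta>"
    and \<Omega>: "AE z in P. fst z \<in> \<Omega>"
    and bias: "\<And>x'. x' \<in> \<Omega> \<Longrightarrow> dist x x' < r \<Longrightarrow> 1/2 + a \<le> (if b then \<eta> x' else 1 - \<eta> x')"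
    and a: "a \<le> 1/2" and u: "0 \<le> u"
    and p: "p \<le> measure P {z \<in> space P. dist x (fst z) < r}"
    and np: "2 * (1 + u) * real k \<le> real n * p"
  shows "(\<integral>\<^sup>+D. ennreal (exp (- u * (\<Sum>i<k. of_bool (snd (nearest D n x i) = b) - 1/2)))
            \<partial>PiM {..<n} (\<lambda>_. P)) \<le> ennreal (2 * exp (real k * (- u * a + u\<^sup>2 / 8)))"
proof -
  note [measurable_cong] = sets
  interpret P: prob_space P by fact
  interpret product_sigma_finite "\<lambda>_. P" by unfold_locales
  have emsp: "emeasure (PiM {..<n} (\<lambda>_. P)) (space (PiM {..<n} (\<lambda>_. P))) = 1"
    by (intro prob_space.emeasure_space_1 prob_space_PiM P)
  have [measurable]: "\<eta> \<in> borel_measurable borel" and rng: "\<And>x. 0 \<le> \<eta> x" "\<And>x. \<eta> x \<le> 1"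
    using reg unfolding regression_function_def by auto
  define p' where "p' = measure P {z \<in> space P. dist x (fst z) < r}"
  have p': "0 \<le> p'" "p' \<le> 1" "p \<le> p'" using p by (auto simp: p'_def)
  have np': "2 * (1 + u) * real k \<le> real n * p'"
    using np p' mult_left_mono[of p p' "real n"] by linarith
  have kn: "k \<le> n"
  proof -
    have "real k \<le> 2 * (1 + u) * real k" using u mult_right_mono[of 1 "2 * (1 + u)" "real k"] by simp
    also have "\<dots> \<le> real n * 1" using np' mult_left_mono[of p' 1 "real n"] p' by linarith
    finally show ?thesis by simp
  qed
  define \<psi> where "\<psi> = - u * a + u\<^sup>2 / 8"
  define q where "q x' = (if b then \<eta> x' else 1 - \<eta> x')" for x'
  define m where "m x' = q x' * exp (- (u / 2)) + (1 - q x') * exp (u / 2)" for x'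
  have q: "0 \<le> q x'" "q x' \<le> 1" for x' using rng by (auto simp: q_def)
  have m0: "0 \<le> m x'" for x' unfolding m_def using q by (intro add_nonneg_nonneg mult_nonneg_nonneg) auto
  have m1: "m x' \<le> exp (u / 2)" for x'
    unfolding m_def using q[of x'] u mult_left_mono[of "exp (-(u/2))" "exp (u/2)" "q x'"]
    by (simp add: algebra_simps)
  have m2: "m x' \<le> exp \<psi>" if "x' \<in> \<Omega>" "dist x x' < r" for x'
    unfolding m_def \<psi>_def using bias[OF that] q[of x'] u by (intro bernoulli_mgf_le) (auto simp: q_def)
  define I where "I z = (of_bool (dist x (fst z) < r) :: real)" for z :: "(real^'d) \<times> bool"
  have [measurable]: "I \<in> borel_measurable labelled_space" unfolding I_def by measurable
  define G where "G y = ennreal (exp (- u * (of_bool (y = b) - 1/2)))" for y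
  have Gm: "ennreal (\<eta> x') * G True + ennreal (1 - \<eta> x') * G False = ennreal (m x')" for x'
    using rng[of x'] by (cases b) (auto simp: G_def m_def q_def simp flip: ennreal_mult' ennreal_plus)
  have "(\<integral>\<^sup>+D. ennreal (exp (- u * (\<Sum>i<k. of_bool (snd (nearest D n x i) = b) - 1/2))) \<partial>PiM {..<n} (\<lambda>_. P))
      = (\<integral>\<^sup>+D. (\<Prod>i<k. G (snd (nearest D n x i))) \<partial>PiM {..<n} (\<lambda>_. P))"
    unfolding G_def by (intro nn_integral_cong) (simp add: prod_ennreal exp_sum sum_distrib_left)
  also have "\<dots> = (\<integral>\<^sup>+D. (\<Prod>i<k. ennreal (m (fst (nearest D n x i)))) \<partial>PiM {..<n} (\<lambda>_. P))"
    unfolding nn_integral_nearest_labels[OF P sets reg kn] Gm ..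
  also have "\<dots> \<le> (\<integral>\<^sup>+D. ennreal (exp (real k * \<psi>)) + ennreal (exp (real k * (u/2) + real k)) * (\<Prod>j<n. ennreal (exp (- I (D j)))) \<partial>PiM {..<n} (\<lambda>_. P))"
  proof (rule nn_integral_mono_AE)
    have "AE D in PiM {..<n} (\<lambda>_. P). \<forall>j\<in>{..<n}. fst (D j) \<in> \<Omega>"
      by (intro AE_finite_allI AE_PiM_component) (use \<Omega> P in auto)
    thus "AE D in PiM {..<n} (\<lambda>_. P). (\<Prod>i<k. ennreal (m (fst (nearest D n x i)))) \<le>
       ennreal (exp (real k * \<psi>)) + ennreal (exp (real k * (u/2) + real k)) * (\<Prod>j<n. ennreal (exp (- I (D j))))"
    proof eventually_elim
      fix D :: "nat \<Rightarrow> (real^'d) \<times> bool" assume D: "\<forall>j\<in>{..<n}. fst (D j) \<in> \<Omega>"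
      define c where "c = card {j. j < n \<and> dist x (fst (D j)) < r}"
      have sI: "(\<Sum>j<n. I (D j)) = real c"
      proof -
        have "(\<Sum>j<n. I (D j)) = real (card ({..<n} \<inter> {j. dist x (fst (D j)) < r}))"
          unfolding I_def by (simp add: sum_of_bool_eq)
        also have "{..<n} \<inter> {j. dist x (fst (D j)) < r} = {j. j < n \<and> dist x (fst (D j)) < r}" by auto
        finally show ?thesis unfolding c_def .
      qed
      have prI: "(\<Prod>j<n. exp (- I (D j))) = exp (- real c)"
        by (simp add: exp_sum[symmetric] sum_negf sI)
      have "(\<Prod>i<k. m (fst (nearest D n x i))) \<le> exp (real k * \<psi>) + exp (real k * (u/2) + real k) * exp (- real c)"
      proof (cases "k \<le> c")
        case True
        have "(\<Prod>i<k. m (fst (nearest D n x i))) \<le> (\<Prod>i<k. exp \<psi>)"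
        proof (intro prod_mono conjI m0 m2)
          fix i assume i: "i \<in> {..<k}"
          have "sort_key (\<lambda>j. dist x (fst (D j))) [0..<n] ! i \<in> set (sort_key (\<lambda>j. dist x (fst (D j))) [0..<n])"
            using i kn by (intro nth_mem) auto
          thus "fst (nearest D n x i) \<in> \<Omega>" using D unfolding nearest_def by auto
          show "dist x (fst (nearest D n x i)) < r" unfolding nearest_def
            by (rule sort_key_nth_less[where f = "\<lambda>j. dist x (fst (D j))", OF True[unfolded c_def]]) (use i in auto)
        qed
        also have "\<dots> = exp (real k * \<psi>)" by (simp add: exp_of_nat_mult)
        finally show ?thesis by (smt (verit) exp_gt_zero mult_pos_pos)
      next
        case False
        have "(\<Prod>i<k. m (fst (nearest D n x i))) \<le> (\<Prod>i<k. exp (u / 2))"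
          by (intro prod_mono conjI m0 m1)
        also have "\<dots> = exp (real k * (u / 2))" by (simp only: prod_constant card_lessThan exp_of_nat_mult)
        also have "\<dots> \<le> exp (real k * (u/2) + real k) * exp (- real c)"
          using False by (simp flip: exp_add)
        finally show ?thesis by (smt (verit) exp_gt_zero)
      qed
      thus "(\<Prod>i<k. ennreal (m (fst (nearest D n x i)))) \<le>
       ennreal (exp (real k * \<psi>)) + ennreal (exp (real k * (u/2) + real k)) * (\<Prod>j<n. ennreal (exp (- I (D j))))"
        by (simp add: prod_ennreal m0 prI flip: ennreal_mult' ennreal_plus)
    qed
  qed
  also have "\<dots> = ennreal (exp (real k * \<psi>)) + ennreal (exp (real k * (u/2) + real k)) * 
     (\<integral>\<^sup>+D. (\<Prod>j<n. ennreal (exp (- I (D j)))) \<partial>PiM {..<n} (\<lambda>_. P))"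
  proof -
    have [measurable]: "(\<lambda>D. \<Prod>j<n. ennreal (exp (- I (D j)))) \<in> borel_measurable (PiM {..<n} (\<lambda>_. P))" by measurable
    show ?thesis by (subst nn_integral_add) (auto simp: nn_integral_cmult emsp)
  qed
  also have "(\<integral>\<^sup>+D. (\<Prod>j<n. ennreal (exp (- I (D j)))) \<partial>PiM {..<n} (\<lambda>_. P)) = (\<integral>\<^sup>+z. ennreal (exp (- I z)) \<partial>P) ^ n"
    by (subst product_nn_integral_prod) auto
  also have "(\<integral>\<^sup>+z. ennreal (exp (- I z)) \<partial>P) = ennreal (1 - (1 - exp (-1)) * p')"
  proof -
    have eq: "exp (- I z) = 1 - (1 - exp (-1)) * indicator {z \<in> space P. dist x (fst z) < r} z" if "z \<in> space P" for z
      using that by (auto simp: I_def indicator_def)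
    have "(\<integral>\<^sup>+z. ennreal (exp (- I z)) \<partial>P) = ennreal (\<integral>z. exp (- I z) \<partial>P)"
      by (intro nn_integral_eq_integral P.integrable_const_bound[where B = 1]) (auto simp: I_def)
    also have "(\<integral>z. exp (- I z) \<partial>P) = (\<integral>z. 1 - (1 - exp (-1)) * indicator {z \<in> space P. dist x (fst z) < r} z \<partial>P)"
      by (intro Bochner_Integration.integral_cong refl eq)
    also have "\<dots> = 1 - (1 - exp (-1)) * p'"
      unfolding p'_def by (subst Bochner_Integration.integral_diff) (auto simp: P.prob_space P.emeasure_eq_measure intro!: integrable_mult_right integrable_real_indicator)
    finally show ?thesis .
  qed
  also have "ennreal (1 - (1 - exp (-1)) * p') ^ n \<le> ennreal (exp (- (p' / 2))) ^ n"
  proof (intro power_mono ennreal_leI)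
    \<comment> \<open>\<open>1 - 1 / e \<ge> 1 / 2\<close> is all that is needed of the Chernoff factor.\<close>
    have "2 * exp (-1) \<le> (1::real)"
      using exp_ge_add_one_self[of "1::real"] by (simp add: exp_minus field_simps)
    hence "p' / 2 \<le> (1 - exp (-1)) * p'" using p' mult_right_mono[of "1/2" "1 - exp (-1)" p'] by simp
    hence "1 - (1 - exp (-1)) * p' \<le> 1 + (- (p' / 2))" by simp
    also have "\<dots> \<le> exp (- (p' / 2))" by (rule exp_ge_add_one_self)
    finally show "1 - (1 - exp (-1)) * p' \<le> exp (- (p' / 2))" .
  qed auto
  also have "ennreal (exp (- (p' / 2))) ^ n = ennreal (exp (- (real n * p' / 2)))"
    by (simp add: ennreal_power flip: exp_of_nat_mult)
  also have "ennreal (exp (real k * \<psi>)) + ennreal (exp (real k * (u/2) + real k)) * ennreal (exp (- (real n * p' / 2)))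
      = ennreal (exp (real k * \<psi>) + exp (real k * (u/2) + real k - real n * p' / 2))"
  proof -
    have e: "exp (real k * (u/2) + real k - real n * p' / 2) =
       exp (real k * (u/2) + real k) * exp (- (real n * p' / 2))"
      by (simp flip: exp_add)
    show ?thesis unfolding e by (simp add: ennreal_plus ennreal_mult')
  qed
  also have "\<dots> \<le> ennreal (2 * exp (real k * \<psi>))"
  proof (intro ennreal_leI)
    have "real k * (u/2) + real k - real n * p' / 2 \<le> real k * (- u * (1/2))"
      using np' by (simp add: algebra_simps)
    also have "\<dots> \<le> real k * \<psi>"
    proof (rule mult_left_mono)
      have "u * a \<le> u * (1/2)" using a u by (intro mult_left_mono) auto
      moreover have "0 \<le> u\<^sup>2 / 8" by simp
      ultimately show "- u * (1/2) \<le> \<psi>" unfolding \<psi>_def by linarith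
    qed simp
    finally show "exp (real k * \<psi>) + exp (real k * (u/2) + real k - real n * p' / 2) \<le> 2 * exp (real k * \<psi>)"
      by simp
  qed
  finally show ?thesis unfolding \<psi>_def by (simp add: add_left_mono mult_left_mono)
qed

section \<open>Error probabilities and excess risk\<close>

text \<open>
  The ranking takes only finitely many values, and given its value the neighbour is a fixed member
  of the sample.
\<close>
lemma measurable_nearest:
  fixes D :: "'a \<Rightarrow> nat \<Rightarrow> (real ^ 'd) \<times> bool"
  assumes D: "\<And>j. j < n \<Longrightarrow> (\<lambda>\<omega>. D \<omega> j) \<in> measurable M labelled_space"
    and f: "f \<in> borel_measurable M" and i: "i < n"
  shows "(\<lambda>\<omega>. nearest (D \<omega>) n (f \<omega>) i) \<in> measurable M labelled_space"
proof -
  let ?s = "\<lambda>\<omega>. sort_key (\<lambda>j. dist (f \<omega>) (fst (D \<omega> j))) [0..<n]"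
  let ?L = "{l. length l = n \<and> set l \<subseteq> {..<n}}"
  have "?s \<in> measurable M (count_space UNIV)"
    by (rule measurable_sort_key_dist[OF _ f]) (rule measurable_compose[OF D], auto)
  hence s: "?s \<in> measurable M (count_space ?L)"
    by (rule measurable_count_space_extend[rotated 2]) auto
  have L: "finite ?L"
    by (rule finite_subset[OF _ finite_lists_length_eq[of "{..<n}" n]]) auto
  have "(\<lambda>\<omega>. D \<omega> (?s \<omega> ! i)) \<in> measurable M labelled_space"
  proof (rule measurable_compose_countable'[where f = "\<lambda>l \<omega>. D \<omega> (l ! i)", OF _ s])
    fix l assume "l \<in> ?L"
    hence "l ! i < n" using i nth_mem[of i l] by (auto simp del: nth_mem)
    thus "(\<lambda>\<omega>. D \<omega> (l ! i)) \<in> measurable M labelled_space" by (rule D)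
  qed (use L in \<open>auto intro: countable_finite\<close>)
  thus ?thesis unfolding nearest_def .
qed

lemma measurable_nearest_label:
  fixes D :: "'a \<Rightarrow> nat \<Rightarrow> (real ^ 'd) \<times> bool"
  assumes D: "\<And>j. j < n \<Longrightarrow> (\<lambda>\<omega>. D \<omega> j) \<in> measurable M labelled_space"
    and f: "f \<in> borel_measurable M" and i: "i < n"
  shows "Measurable.pred M (\<lambda>\<omega>. snd (nearest (D \<omega>) n (f \<omega>) i))"
  by (rule measurable_compose[OF measurable_nearest[OF assms]]) auto

lemma measurable_classifier_NN:
  fixes DP DQ :: "'a \<Rightarrow> nat \<Rightarrow> (real ^ 'd) \<times> bool"
  assumes D: "\<And>j. j < nP \<Longrightarrow> (\<lambda>\<omega>. DP \<omega> j) \<in> measurable M labelled_space"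
             "\<And>j. j < nQ \<Longrightarrow> (\<lambda>\<omega>. DQ \<omega> j) \<in> measurable M labelled_space"
    and f: "f \<in> borel_measurable M" and k: "kP \<le> nP" "kQ \<le> nQ"
  shows "Measurable.pred M (\<lambda>\<omega>. classifier_NN nP nQ wP wQ kP kQ (DP \<omega>) (DQ \<omega>) (f \<omega>))"
proof -
  have "(\<lambda>\<omega>. of_bool (snd (nearest (DP \<omega>) nP (f \<omega>) i)) :: real) \<in> borel_measurable M" if "i < kP" for i
    using measurable_nearest_label[OF D(1) f] that k by simp
  moreover have "(\<lambda>\<omega>. of_bool (snd (nearest (DQ \<omega>) nQ (f \<omega>) i)) :: real) \<in> borel_measurable M" if "i < kQ" for i
    using measurable_nearest_label[OF D(2) f] that k by simp
  ultimately show ?thesis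
    unfolding classifier_NN_def eta_NN_def
    by (cases "kP = 0 \<and> kQ = 0")
       (auto intro!: borel_measurable_less borel_measurable_divide borel_measurable_add borel_measurable_times borel_measurable_sum)
qed

text \<open>
  The vote is counted relative to a label \<open>b\<close>, so that the two kinds of error are treated at once.
  The classifier answers 0 on a tie, which is why only a weak inequality results.
\<close>
lemma classifier_NN_wrong:
  assumes "wP > 0" "wQ > 0" "classifier_NN nP nQ wP wQ kP kQ DP DQ x \<noteq> b"
  shows "wP * (\<Sum>i<kP. of_bool (snd (nearest DP nP x i) = b) - 1/2) +
         wQ * (\<Sum>i<kQ. of_bool (snd (nearest DQ nQ x i) = b) - 1/2) \<le> (0::real)"
proof (cases "kP = 0 \<and> kQ = 0")
  case False
  define SP where "SP = (\<Sum>i<kP. of_bool (snd (nearest DP nP x i)) :: real)"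
  define SQ where "SQ = (\<Sum>i<kQ. of_bool (snd (nearest DQ nQ x i)) :: real)"
  have pos: "wP * real kP + wQ * real kQ > 0"
    using False assms by (auto intro: add_pos_nonneg add_nonneg_pos)
  have cl: "classifier_NN nP nQ wP wQ kP kQ DP DQ x \<longleftrightarrow> wP * SP + wQ * SQ > (wP * real kP + wQ * real kQ) / 2"
    using False pos unfolding classifier_NN_def eta_NN_def SP_def SQ_def by (auto simp: field_simps)
  show ?thesis
  proof (cases b)
    case True
    have e: "(\<Sum>i<kP. of_bool (snd (nearest DP nP x i) = b) - 1/2) = SP - real kP / 2"
         "(\<Sum>i<kQ. of_bool (snd (nearest DQ nQ x i) = b) - 1/2) = SQ - real kQ / 2"
      using True by (simp_all add: SP_def SQ_def sum_subtractf)
    show ?thesis unfolding e using cl assms(3) True by (simp add: algebra_simps add_divide_distrib)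
  next
    case F: False
    have e: "(\<Sum>i<kP. of_bool (snd (nearest DP nP x i) = b) - 1/2) = real kP / 2 - SP"
         "(\<Sum>i<kQ. of_bool (snd (nearest DQ nQ x i) = b) - 1/2) = real kQ / 2 - SQ"
      using F by (simp_all add: SP_def SQ_def sum_subtractf of_bool_not_iff)
    show ?thesis unfolding e using cl assms(3) F by (simp add: algebra_simps add_divide_distrib)
  qed
qed simp

text \<open>
  Chernoff's bound for the combined vote.  The samples are independent, so the exponential moment
  factorises.
\<close>
lemma misclassification_probability:
  fixes P Q :: "((real ^ 'd) \<times> bool) measure" and x :: "real ^ 'd"
  assumes P: "prob_space P" "sets P = sets labelled_space"
    and Q: "prob_space Q" "sets Q = sets labelled_space"
    and k: "kP \<le> nP" "kQ \<le> nQ" and w: "wP > 0" "wQ > 0" and s: "s \<ge> 0"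
    and bP: "(\<integral>\<^sup>+D. ennreal (exp (- (s * wP) * (\<Sum>i<kP. of_bool (snd (nearest D nP x i) = b) - 1/2)))
            \<partial>PiM {..<nP} (\<lambda>_. P)) \<le> ennreal BP"
    and bQ: "(\<integral>\<^sup>+D. ennreal (exp (- (s * wQ) * (\<Sum>i<kQ. of_bool (snd (nearest D nQ x i) = b) - 1/2)))
            \<partial>PiM {..<nQ} (\<lambda>_. Q)) \<le> ennreal BQ"
    and B: "0 \<le> BP" "0 \<le> BQ"
  shows "(\<integral>\<^sup>+D. of_bool (classifier_NN nP nQ wP wQ kP kQ (fst D) (snd D) x \<noteq> b) \<partial>data_distribution P nP Q nQ)
     \<le> ennreal (BP * BQ)"
proof -
  note [measurable_cong] = P(2) Q(2)
  define VP where "VP D = (\<Sum>i<kP. of_bool (snd (nearest D nP x i) = b) - 1/2 :: real)" for D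
  define VQ where "VQ D = (\<Sum>i<kQ. of_bool (snd (nearest D nQ x i) = b) - 1/2 :: real)" for D
  have cP: "(\<lambda>D. D j) \<in> measurable (PiM {..<nP} (\<lambda>_. P)) labelled_space" if "j < nP" for j
    by measurable (use that in auto)
  have cQ: "(\<lambda>D. D j) \<in> measurable (PiM {..<nQ} (\<lambda>_. Q)) labelled_space" if "j < nQ" for j
    by measurable (use that in auto)
  have [measurable]: "VP \<in> borel_measurable (PiM {..<nP} (\<lambda>_. P))"
    unfolding VP_def
  proof (intro borel_measurable_sum)
    fix i assume "i \<in> {..<kP}"
    hence [measurable]: "Measurable.pred (PiM {..<nP} (\<lambda>_. P)) (\<lambda>D. snd (nearest D nP x i))"
      using k by (intro measurable_nearest_label[OF cP]) auto
    show "(\<lambda>D. of_bool (snd (nearest D nP x i) = b) - 1/2 :: real) \<in> borel_measurable (PiM {..<nP} (\<lambda>_. P))"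
      by measurable
  qed
  have [measurable]: "VQ \<in> borel_measurable (PiM {..<nQ} (\<lambda>_. Q))"
    unfolding VQ_def
  proof (intro borel_measurable_sum)
    fix i assume "i \<in> {..<kQ}"
    hence [measurable]: "Measurable.pred (PiM {..<nQ} (\<lambda>_. Q)) (\<lambda>D. snd (nearest D nQ x i))"
      using k by (intro measurable_nearest_label[OF cQ]) auto
    show "(\<lambda>D. of_bool (snd (nearest D nQ x i) = b) - 1/2 :: real) \<in> borel_measurable (PiM {..<nQ} (\<lambda>_. Q))"
      by measurable
  qed
  interpret PQ: prob_space "PiM {..<nQ} (\<lambda>_. Q)" by (intro prob_space_PiM Q)
  have "(\<integral>\<^sup>+D. of_bool (classifier_NN nP nQ wP wQ kP kQ (fst D) (snd D) x \<noteq> b) \<partial>data_distribution P nP Q nQ)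
     \<le> (\<integral>\<^sup>+D. ennreal (exp (- (s * wP) * VP (fst D))) * ennreal (exp (- (s * wQ) * VQ (snd D))) \<partial>data_distribution P nP Q nQ)"
  proof (rule nn_integral_mono)
    fix D
    show "of_bool (classifier_NN nP nQ wP wQ kP kQ (fst D) (snd D) x \<noteq> b) \<le>
      ennreal (exp (- (s * wP) * VP (fst D))) * ennreal (exp (- (s * wQ) * VQ (snd D)))"
    proof (cases "classifier_NN nP nQ wP wQ kP kQ (fst D) (snd D) x = b")
      case False
      have "wP * VP (fst D) + wQ * VQ (snd D) \<le> 0"
        unfolding VP_def VQ_def by (rule classifier_NN_wrong[OF w False])
      hence "0 \<le> - s * (wP * VP (fst D) + wQ * VQ (snd D))"
        using s by (simp add: mult_nonneg_nonpos)
      hence "1 \<le> exp (- (s * wP) * VP (fst D) + (- (s * wQ) * VQ (snd D)))"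
        by (simp add: algebra_simps)
      hence "1 \<le> ennreal (exp (- (s * wP) * VP (fst D) + (- (s * wQ) * VQ (snd D))))"
        by (simp only: ennreal_ge_1)
      also have "\<dots> = ennreal (exp (- (s * wP) * VP (fst D))) * ennreal (exp (- (s * wQ) * VQ (snd D)))"
        by (simp only: exp_add) (simp add: ennreal_mult')
      finally show ?thesis using False by simp
    qed auto
  qed
  also have "\<dots> = (\<integral>\<^sup>+DP. (\<integral>\<^sup>+DQ. ennreal (exp (- (s * wP) * VP DP)) * ennreal (exp (- (s * wQ) * VQ DQ)) \<partial>PiM {..<nQ} (\<lambda>_. Q)) \<partial>PiM {..<nP} (\<lambda>_. P))"
    unfolding data_distribution_def by (subst PQ.nn_integral_fst[symmetric]) auto
  also have "\<dots> = (\<integral>\<^sup>+DP. ennreal (exp (- (s * wP) * VP DP)) \<partial>PiM {..<nP} (\<lambda>_. P)) *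
                  (\<integral>\<^sup>+DQ. ennreal (exp (- (s * wQ) * VQ DQ)) \<partial>PiM {..<nQ} (\<lambda>_. Q))"
    by (simp add: nn_integral_cmult nn_integral_multc)
  also have "\<dots> \<le> ennreal BP * ennreal BQ"
    using bP bQ unfolding VP_def VQ_def by (intro mult_mono) auto
  finally show ?thesis using B by (simp add: ennreal_mult')
qed

text \<open>
  Conditionally on the covariate, a classifier errs with probability \<open>\<eta>\<close> or \<open>1 - \<eta>\<close>, and the Bayes
  classifier picks the smaller of the two.
\<close>
lemma excess_risk_eq:
  fixes Q :: "((real ^ 'd) \<times> bool) measure"
  assumes P: "prob_space Q" and sets: "sets Q = sets labelled_space"
    and reg: "regression_function Q \<eta>" and f [measurable]: "Measurable.pred borel f"
  shows "excess_risk Q \<eta> f = (\<integral>x. \<bar>2 * \<eta> x - 1\<bar> * of_bool (f x \<noteq> bayes_classifier \<eta> x) \<partial>X_marginal Q)"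
proof -
  note [measurable_cong] = sets
  interpret prob_space Q by fact
  have [measurable]: "\<eta> \<in> borel_measurable borel" and rng: "\<And>x. 0 \<le> \<eta> x" "\<And>x. \<eta> x \<le> 1"
    using reg unfolding regression_function_def by auto
  have [measurable]: "Measurable.pred borel (bayes_classifier \<eta>)"
    unfolding bayes_classifier_def by measurable
  define c where "c f x = (if f x then 1 - \<eta> x else \<eta> x)" for f x
  have c01: "0 \<le> c f x" "c f x \<le> 1" for f x using rng by (auto simp: c_def)
  have int: "integrable Q (\<lambda>z. c f (fst z))" if [measurable]: "Measurable.pred borel f" for f
    by (rule integrable_const_bound[where B = 1]) (use c01 in \<open>auto simp: c_def\<close>)
  have risk: "risk Q f = (\<integral>z. c f (fst z) \<partial>Q)" if [measurable]: "Measurable.pred borel f" for f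
  proof -
    have "emeasure Q {z \<in> space Q. snd z \<noteq> f (fst z)} = (\<integral>\<^sup>+z. of_bool (snd z \<noteq> f (fst z)) \<partial>Q)"
      
    proof -
      have "(\<integral>\<^sup>+z. of_bool (snd z \<noteq> f (fst z)) \<partial>Q) = (\<integral>\<^sup>+z. indicator {z \<in> space Q. snd z \<noteq> f (fst z)} z \<partial>Q)"
        by (rule nn_integral_cong) (simp add: indicator_def)
      thus ?thesis by simp
    qed
    also have "\<dots> = (\<integral>\<^sup>+z. ennreal (c f (fst z)) \<partial>Q)"
      by (subst regression_function_nn_integral[OF P sets reg]) (auto intro!: nn_integral_cong simp: c_def)
    also have "\<dots> = ennreal (\<integral>z. c f (fst z) \<partial>Q)"
      by (intro nn_integral_eq_integral int) (use c01 in auto)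
    finally show ?thesis unfolding risk_def measure_def
      by (simp add: c01 integral_nonneg)
  qed
  have "excess_risk Q \<eta> f = (\<integral>z. c f (fst z) - c (bayes_classifier \<eta>) (fst z) \<partial>Q)"
    unfolding excess_risk_def by (simp add: risk int)
  also have "\<dots> = (\<integral>z. \<bar>2 * \<eta> (fst z) - 1\<bar> * of_bool (f (fst z) \<noteq> bayes_classifier \<eta> (fst z)) \<partial>Q)"
    by (intro Bochner_Integration.integral_cong refl) (auto simp: c_def bayes_classifier_def)
  also have "\<dots> = (\<integral>x. \<bar>2 * \<eta> x - 1\<bar> * of_bool (f x \<noteq> bayes_classifier \<eta> x) \<partial>X_marginal Q)"
    unfolding X_marginal_def by (subst integral_distr) auto
  finally show ?thesis .
qed

text \<open>
  A function that is not integrable has Bochner integral 0, so in that case the claim is \<open>0 \<le> c\<close>.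
\<close>
lemma integral_le_of_nn_integral_le:
  fixes f :: "'a \<Rightarrow> real"
  assumes "(\<integral>\<^sup>+x. ennreal (f x) \<partial>M) \<le> ennreal c" "c \<ge> 0" 
  shows "(\<integral>x. f x \<partial>M) \<le> c"
proof (cases "integrable M f")
  case True
  have "(\<integral>x. f x \<partial>M) \<le> enn2real (\<integral>\<^sup>+x. ennreal (f x) \<partial>M)"
    by (subst real_lebesgue_integral_def[OF True]) simp
  also have "\<dots> \<le> c" using assms by (simp add: enn2real_leI)
  finally show ?thesis .
qed (use assms in \<open>simp add: not_integrable_integral_eq\<close>)

text \<open>
  By Fubini's theorem the expected excess risk is governed by the pointwise error probabilities.
\<close>
lemma expected_excess_risk_NN_le:
  fixes P Q :: "((real ^ 'd) \<times> bool) measure"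
  assumes P: "prob_space P" "sets P = sets labelled_space"
    and Q: "prob_space Q" "sets Q = sets labelled_space"
    and reg: "regression_function Q \<eta>" and k: "kP \<le> nP" "kQ \<le> nQ" and c: "c \<ge> 0"
    and bound: "(\<integral>\<^sup>+x. ennreal \<bar>\<eta> x - 1/2\<bar> * (\<integral>\<^sup>+D. of_bool (classifier_NN nP nQ wP wQ kP kQ (fst D) (snd D) x \<noteq> bayes_classifier \<eta> x)
              \<partial>data_distribution P nP Q nQ) \<partial>X_marginal Q) \<le> ennreal c"
  shows "expected_excess_risk_NN nP nQ wP wQ kP kQ P Q \<eta> \<le> 2 * c"
proof -
  note [measurable_cong] = P(2) Q(2)
  have [measurable]: "\<eta> \<in> borel_measurable borel" and rng: "\<And>x. 0 \<le> \<eta> x" "\<And>x. \<eta> x \<le> 1"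
    using reg unfolding regression_function_def by auto
  have [measurable]: "Measurable.pred borel (bayes_classifier \<eta>)"
    unfolding bayes_classifier_def by measurable
  let ?A = "data_distribution P nP Q nQ"
  let ?M = "X_marginal Q"
  let ?f = "\<lambda>D. classifier_NN nP nQ wP wQ kP kQ (fst D) (snd D)"
  have sM[measurable_cong]: "sets ?M = sets borel" by (simp add: X_marginal_def)
  interpret M: prob_space ?M unfolding X_marginal_def by (intro prob_space.prob_space_distr Q) measurable
  interpret PP: prob_space "PiM {..<nP} (\<lambda>_. P)" by (intro prob_space_PiM P)
  interpret PQ: prob_space "PiM {..<nQ} (\<lambda>_. Q)" by (intro prob_space_PiM Q)
  interpret pp: pair_prob_space "PiM {..<nP} (\<lambda>_. P)" "PiM {..<nQ} (\<lambda>_. Q)" ..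
  interpret A: prob_space ?A unfolding data_distribution_def by unfold_locales
  interpret AM: pair_sigma_finite ?A ?M ..
  have [measurable]: "Measurable.pred (?A \<Otimes>\<^sub>M ?M) (\<lambda>\<omega>. ?f (fst \<omega>) (snd \<omega>))"
  proof (rule measurable_classifier_NN[OF _ _ _ k])
    show "(\<lambda>\<omega>. fst (fst \<omega>) j) \<in> measurable (?A \<Otimes>\<^sub>M ?M) labelled_space" if "j < nP" for j
      unfolding data_distribution_def by measurable (use that in auto)
    show "(\<lambda>\<omega>. snd (fst \<omega>) j) \<in> measurable (?A \<Otimes>\<^sub>M ?M) labelled_space" if "j < nQ" for j
      unfolding data_distribution_def by measurable (use that in auto)
  qed measurable
  have fm: "Measurable.pred borel (?f D)" for D
    by (rule measurable_classifier_NN[OF _ _ _ k]) (auto simp: space_pair_measure)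
  have er: "ennreal (excess_risk Q \<eta> (?f D)) =
     2 * (\<integral>\<^sup>+x. ennreal \<bar>\<eta> x - 1/2\<bar> * of_bool (?f D x \<noteq> bayes_classifier \<eta> x) \<partial>?M)" for D
  proof -
    note [measurable] = fm[of D]
    have "integrable ?M (\<lambda>x. \<bar>2 * \<eta> x - 1\<bar> * of_bool (?f D x \<noteq> bayes_classifier \<eta> x))"
    proof (rule M.integrable_const_bound[where B = 1])
      show "AE x in ?M. norm (\<bar>2 * \<eta> x - 1\<bar> * of_bool (?f D x \<noteq> bayes_classifier \<eta> x)) \<le> 1"
        using rng by (intro AE_I2) (auto simp: abs_le_iff)
    qed measurable
    hence "ennreal (excess_risk Q \<eta> (?f D)) = (\<integral>\<^sup>+x. ennreal (\<bar>2 * \<eta> x - 1\<bar> * of_bool (?f D x \<noteq> bayes_classifier \<eta> x)) \<partial>?M)"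
      unfolding excess_risk_eq[OF Q reg fm] by (intro nn_integral_eq_integral[symmetric]) auto
    also have "\<dots> = (\<integral>\<^sup>+x. 2 * (ennreal \<bar>\<eta> x - 1/2\<bar> * of_bool (?f D x \<noteq> bayes_classifier \<eta> x)) \<partial>?M)"
    proof (intro nn_integral_cong)
      fix x
      have "\<bar>2 * \<eta> x - 1\<bar> = 2 * \<bar>\<eta> x - 1/2\<bar>"
        using abs_mult[of 2 "\<eta> x - 1/2"] by (simp add: right_diff_distrib)
      thus "ennreal (\<bar>2 * \<eta> x - 1\<bar> * of_bool (?f D x \<noteq> bayes_classifier \<eta> x)) =
        2 * (ennreal \<bar>\<eta> x - 1/2\<bar> * of_bool (?f D x \<noteq> bayes_classifier \<eta> x))"
        by (simp add: ennreal_mult')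
    qed
    also have "\<dots> = 2 * (\<integral>\<^sup>+x. ennreal \<bar>\<eta> x - 1/2\<bar> * of_bool (?f D x \<noteq> bayes_classifier \<eta> x) \<partial>?M)"
      by (rule nn_integral_cmult) measurable
    finally show ?thesis .
  qed
  have "(\<integral>\<^sup>+D. ennreal (excess_risk Q \<eta> (?f D)) \<partial>?A) =
    2 * (\<integral>\<^sup>+D. (\<integral>\<^sup>+x. ennreal \<bar>\<eta> x - 1/2\<bar> * of_bool (?f D x \<noteq> bayes_classifier \<eta> x) \<partial>?M) \<partial>?A)"
    unfolding er by (rule nn_integral_cmult) measurable
  also have "(\<integral>\<^sup>+D. (\<integral>\<^sup>+x. ennreal \<bar>\<eta> x - 1/2\<bar> * of_bool (?f D x \<noteq> bayes_classifier \<eta> x) \<partial>?M) \<partial>?A) = (\<integral>\<^sup>+x. (\<integral>\<^sup>+D. ennreal \<bar>\<eta> x - 1/2\<bar> * of_bool (?f D x \<noteq> bayes_classifier \<eta> x) \<partial>?A) \<partial>?M)"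
    by (rule AM.Fubini'[symmetric]) (simp add: split_beta)
  also have "\<dots> = (\<integral>\<^sup>+x. ennreal \<bar>\<eta> x - 1/2\<bar> * (\<integral>\<^sup>+D. of_bool (?f D x \<noteq> bayes_classifier \<eta> x) \<partial>?A) \<partial>?M)"
  proof (rule nn_integral_cong)
    fix x
    have "Measurable.pred ?A (\<lambda>D. ?f D x)"
      by (rule measurable_classifier_NN[OF _ _ _ k]) (auto simp: data_distribution_def)
    thus "(\<integral>\<^sup>+D. ennreal \<bar>\<eta> x - 1/2\<bar> * of_bool (?f D x \<noteq> bayes_classifier \<eta> x) \<partial>?A) =
      ennreal \<bar>\<eta> x - 1/2\<bar> * (\<integral>\<^sup>+D. of_bool (?f D x \<noteq> bayes_classifier \<eta> x) \<partial>?A)"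
      by (intro nn_integral_cmult) measurable
  qed
  also have "2 * \<dots> \<le> ennreal (2 * c)"
    using bound c mult_left_mono[OF bound, of 2] by (simp add: ennreal_mult')
  finally show ?thesis
    using c c unfolding expected_excess_risk_NN_def by (intro integral_le_of_nn_integral_le) auto
qed

section \<open>Margin and density conditions\<close>

text \<open>
  The peeling argument.  On the shell \<open>\<delta> * 2 ^ (j - 1) \<le> \<Delta> < \<delta> * 2 ^ j\<close> the integrand is at most of order
  \<open>\<delta> * (2 ^ j) powr (- (\<alpha> + 1))\<close>, and the shell has at most mass of order \<open>(\<delta> * 2 ^ j) powr \<alpha>\<close>.  The exponent
  \<open>\<alpha> + 2\<close> in the decay of \<open>q\<close> is chosen so that the products form a geometric series with ratio \<open>1/2\<close>.
\<close>
lemma nn_integral_margin_le: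
  fixes \<Delta> :: "'a \<Rightarrow> real" and q :: "'a \<Rightarrow> ennreal"
  assumes M: "finite_measure M" and [measurable]: "\<Delta> \<in> borel_measurable M"
    and margin: "\<And>t. t > 0 \<Longrightarrow> measure M {x \<in> space M. 0 < \<Delta> x \<and> \<Delta> x < t} \<le> c * t powr \<alpha>"
    and \<Delta>0: "\<And>x. 0 \<le> \<Delta> x" and pos: "\<alpha> \<ge> 0" "\<delta> > 0" "K \<ge> 1" "c > 0"
    and q1: "\<And>x. q x \<le> 1"
    and qK: "AE x in M. 0 < \<Delta> x \<longrightarrow> q x \<le> ennreal (K * (\<delta> / \<Delta> x) powr (\<alpha> + 2))"
  shows "(\<integral>\<^sup>+x. ennreal (\<Delta> x) * q x \<partial>M) \<le> ennreal (K * 2 powr (\<alpha> + 2) * c * \<delta> powr (1 + \<alpha>))"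
proof -
  interpret finite_measure M by fact
  \<comment> \<open>The extra \<open>2 powr (\<alpha> + 1)\<close> pays for the ratio 2 between the ends of a shell.\<close>
  define C where "C = K * 2 powr (\<alpha> + 1)"
  have C: "C \<ge> 1"
    unfolding C_def using pos ge_one_powr_ge_zero[of 2 "\<alpha> + 1"] mult_mono[of 1 K 1 "2 powr (\<alpha>+1)"] by simp
  define a where "a j = C * \<delta> * (2 ^ j) powr (- (\<alpha> + 1))" for j :: nat
  have a0: "0 \<le> a j" for j using C pos by (simp add: a_def)
  define E where "E j = {x \<in> space M. 0 < \<Delta> x \<and> \<Delta> x < \<delta> * 2 ^ j}" for j :: nat
  have [measurable]: "E j \<in> sets M" for j unfolding E_def by measurable
  have pt: "ennreal (\<Delta> x) * q x \<le> (\<Sum>j. ennreal (a j) * indicator (E j) x)"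
    if x: "x \<in> space M" and qx: "0 < \<Delta> x \<longrightarrow> q x \<le> ennreal (K * (\<delta> / \<Delta> x) powr (\<alpha> + 2))" for x
  proof (cases "\<Delta> x = 0")
    case False
    hence dx: "\<Delta> x > 0" using \<Delta>0[of x] by simp
    obtain j0 :: nat where j0: "\<Delta> x / \<delta> < 2 ^ j0" using real_arch_pow[of 2 "\<Delta> x / \<delta>"] by auto
    \<comment> \<open>The least such \<open>j\<close> gives both \<open>\<Delta> x < \<delta> * 2 ^ j\<close> and, for \<open>j > 0\<close>, the reverse bound at \<open>j - 1\<close>.\<close>
    define j where "j = (LEAST j. \<Delta> x < \<delta> * 2 ^ j)"
    have j: "\<Delta> x < \<delta> * 2 ^ j"
      unfolding j_def by (rule LeastI[of _ j0]) (use j0 pos in \<open>simp add: field_simps\<close>)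
    have "ennreal (\<Delta> x) * q x \<le> ennreal (a j)"
    proof (cases j)
      case 0
      have "ennreal (\<Delta> x) * q x \<le> ennreal (\<Delta> x) * 1" by (intro mult_left_mono q1) auto
      also have "\<dots> \<le> ennreal (a j)"
      proof -
        have "\<Delta> x \<le> 1 * \<delta>" using j 0 by simp
        also have "\<dots> \<le> C * \<delta>" using C pos by (intro mult_right_mono) auto
        finally show ?thesis using 0 by (simp add: a_def ennreal_leI)
      qed
      finally show ?thesis .
    next
      case (Suc i)
      have "\<not> \<Delta> x < \<delta> * 2 ^ i" using not_less_Least[of i "\<lambda>j. \<Delta> x < \<delta> * 2 ^ j"] Suc by (simp add: j_def)
      hence i: "\<delta> * 2 ^ i \<le> \<Delta> x" by simp
      have "ennreal (\<Delta> x) * q x \<le> ennreal (\<Delta> x) * ennreal (K * (\<delta> / \<Delta> x) powr (\<alpha> + 2))"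
        using qx dx by (intro mult_left_mono) auto
      also have "\<dots> = ennreal (\<Delta> x * (K * (\<delta> / \<Delta> x) powr (\<alpha> + 2)))"
        using dx by (simp add: ennreal_mult')
      also have "\<Delta> x * (K * (\<delta> / \<Delta> x) powr (\<alpha> + 2)) = K * \<delta> * (\<Delta> x / \<delta>) powr (- (\<alpha> + 1))"
      proof -
        have "(\<delta> / \<Delta> x) powr (\<alpha> + 2) = (\<delta> / \<Delta> x) powr (\<alpha> + 1) * (\<delta> / \<Delta> x) powr 1"
          unfolding powr_add[symmetric] by (simp add: add.assoc)
        also have "(\<delta> / \<Delta> x) powr (\<alpha> + 1) = (\<Delta> x / \<delta>) powr (- (\<alpha> + 1))"
          using dx pos inverse_powr[of "\<Delta> x / \<delta>" "\<alpha> + 1"] unfolding powr_minus by simp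
        finally show ?thesis using dx pos by simp
      qed
      also have "ennreal \<dots> \<le> ennreal (a j)"
      proof (intro ennreal_leI)
        have "(\<Delta> x / \<delta>) powr (- (\<alpha> + 1)) \<le> (2 ^ i) powr (- (\<alpha> + 1))"
          using i pos by (intro powr_mono2') (auto simp: field_simps)
        also have "(2 ^ i) powr (- (\<alpha> + 1)) = 2 powr (\<alpha> + 1) * (2 ^ j) powr (- (\<alpha> + 1))"
          using Suc by (simp add: powr_mult) (simp flip: powr_add)
        finally show "K * \<delta> * (\<Delta> x / \<delta>) powr (- (\<alpha> + 1)) \<le> a j"
          unfolding a_def C_def using pos mult_left_mono[of _ _ "K * \<delta>"] by (simp add: mult_ac)
      qed
      finally show ?thesis .
    qed
    also have "\<dots> = (\<Sum>i\<in>{j}. ennreal (a i) * indicator (E i) x)"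
      using j dx x by (simp add: E_def)
    also have "\<dots> \<le> (\<Sum>j. ennreal (a j) * indicator (E j) x)"
      by (rule sum_le_suminf) auto
    finally show ?thesis .
  qed simp
  have "(\<integral>\<^sup>+x. ennreal (\<Delta> x) * q x \<partial>M) \<le> (\<integral>\<^sup>+x. (\<Sum>j. ennreal (a j) * indicator (E j) x) \<partial>M)"
  proof (rule nn_integral_mono_AE)
    show "AE x in M. ennreal (\<Delta> x) * q x \<le> (\<Sum>j. ennreal (a j) * indicator (E j) x)"
      using qK AE_space by eventually_elim (rule pt)
  qed
  also have "\<dots> = (\<Sum>j. \<integral>\<^sup>+x. ennreal (a j) * indicator (E j) x \<partial>M)"
    by (rule nn_integral_suminf) measurable
  also have "\<dots> = (\<Sum>j. ennreal (a j) * emeasure M (E j))"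
    by (simp add: nn_integral_cmult)
  also have "\<dots> \<le> (\<Sum>j. ennreal (C * c * \<delta> powr (1 + \<alpha>) * (1 / 2) ^ j))"
  proof (intro suminf_le allI)
    fix j
    have "ennreal (a j) * emeasure M (E j) = ennreal (a j * measure M (E j))"
      using a0 by (simp add: emeasure_eq_measure ennreal_mult')
    also have "\<dots> \<le> ennreal (a j * (c * (\<delta> * 2 ^ j) powr \<alpha>))"
      unfolding E_def using pos a0 by (intro ennreal_leI mult_left_mono margin) auto
    also have "a j * (c * (\<delta> * 2 ^ j) powr \<alpha>) = C * c * (\<delta> powr 1 * \<delta> powr \<alpha>) * ((2 ^ j) powr (- (\<alpha> + 1)) * (2 ^ j) powr \<alpha>)"
      unfolding a_def using pos by (simp add: powr_mult)
    also have "\<delta> powr 1 * \<delta> powr \<alpha> = \<delta> powr (1 + \<alpha>)" by (rule powr_add[symmetric])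
    also have "(2 ^ j :: real) powr (- (\<alpha> + 1)) * (2 ^ j) powr \<alpha> = (1 / 2) ^ j"
      by (simp flip: powr_add add: powr_minus_divide power_divide)
    finally show "ennreal (a j) * emeasure M (E j) \<le> ennreal (C * c * \<delta> powr (1 + \<alpha>) * (1 / 2) ^ j)" .
  qed auto
  also have "\<dots> = ennreal (\<Sum>j. C * c * \<delta> powr (1 + \<alpha>) * (1 / 2) ^ j)"
    using C pos by (intro suminf_ennreal2 summable_mult summable_geometric) auto
  also have "(\<Sum>j. C * c * \<delta> powr (1 + \<alpha>) * (1 / 2) ^ j) = C * c * \<delta> powr (1 + \<alpha>) * 2"
    by (subst suminf_mult) (auto simp: suminf_geometric)
  also have "\<dots> = K * 2 powr (\<alpha> + 2) * c * \<delta> powr (1 + \<alpha>)"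
  proof -
    have "2 powr (\<alpha> + 2) = 2 powr (\<alpha> + 1) * (2::real) powr 1"
      unfolding powr_add[symmetric] by (simp add: add.assoc)
    thus ?thesis by (simp add: C_def)
  qed
  finally show ?thesis .
qed

text \<open>
  A ball around a point of the support carries mass of order \<open>r ^ d\<close>: its intersection with the
  support fills a fixed proportion of its volume, and there the density exceeds \<open>m\<close>.
\<close>
lemma ball_mass_ge:
  fixes P :: "((real ^ 'd) \<times> bool) measure" and x :: "real ^ 'd"
  defines "\<Omega> \<equiv> measure_support (X_marginal P)"
  assumes P: "prob_space P" and sets: "sets P = sets labelled_space"
    and dens: "density_between P m m'" and m: "m > 0"
    and vol: "c * measure lborel (ball x r) \<le> measure lborel (\<Omega> \<inter> ball x r)" and r: "r > 0"
  shows "m * c * unit_ball_vol (real CARD('d)) * r ^ CARD('d) \<le> measure P {z \<in> space P. dist x (fst z) < r}"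
proof -
  note [measurable_cong] = sets
  interpret prob_space P by fact
  obtain p where p: "distributed P lborel fst p" and pm: "\<And>y. y \<in> \<Omega> \<Longrightarrow> ennreal m < p y"
    using dens unfolding density_between_def \<Omega>_def by blast
  have "closed \<Omega>" unfolding \<Omega>_def by (rule closed_measure_support) (simp add: X_marginal_def)
  hence [measurable]: "\<Omega> \<in> sets borel" by simp
  have [measurable]: "p \<in> borel_measurable borel"
    using distributed_borel_measurable[OF p] by simp
  have fin: "emeasure lborel (\<Omega> \<inter> ball x r) \<noteq> \<infinity>"
  proof -
    have "emeasure lborel (\<Omega> \<inter> ball x r) \<le> emeasure lborel (ball x r)" by (intro emeasure_mono) auto
    thus ?thesis using emeasure_bounded_finite[of "ball x r"] by (auto simp: less_top)
  qed
  have "ennreal (m * measure lborel (\<Omega> \<inter> ball x r)) = ennreal m * emeasure lborel (\<Omega> \<inter> ball x r)"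
    using m fin by (simp add: emeasure_eq_ennreal_measure ennreal_mult')
  also have "\<dots> = (\<integral>\<^sup>+y. ennreal m * indicator (\<Omega> \<inter> ball x r) y \<partial>lborel)"
    by (subst nn_integral_cmult_indicator) auto
  also have "\<dots> \<le> (\<integral>\<^sup>+y. p y * indicator (ball x r) y \<partial>lborel)"
    by (intro nn_integral_mono) (auto simp: indicator_def intro: less_imp_le pm)
  also have "\<dots> = emeasure P (fst -` ball x r \<inter> space P)"
    by (rule distributed_emeasure[OF p, symmetric]) auto
  also have "fst -` ball x r \<inter> space P = {z \<in> space P. dist x (fst z) < r}" by auto
  also have "emeasure P \<dots> = ennreal (measure P \<dots>)" by (rule emeasure_eq_measure)
  finally have "m * measure lborel (\<Omega> \<inter> ball x r) \<le> measure P {z \<in> space P. dist x (fst z) < r}"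
    by (simp add: ennreal_le_iff)
  moreover have "m * (c * measure lborel (ball x r)) \<le> m * measure lborel (\<Omega> \<inter> ball x r)"
    using m vol by (intro mult_left_mono) auto
  moreover have "measure lborel (ball x r) = unit_ball_vol (real CARD('d)) * r ^ CARD('d)"
    using content_ball[of r x] r by simp
  ultimately show ?thesis by (simp add: mult_ac)
qed

section \<open>Error probability at a point of large margin\<close>

text \<open>
  The error probability at a point whose margin \<open>\<Delta>\<close> exceeds the noise level \<open>\<delta>\<close>.  The Chernoff
  parameter is \<open>s = 4 * c0 * \<tau>\<close> with \<open>\<tau> = t powr min 1 \<gamma>\<close> and \<open>t = \<Delta> / \<delta>\<close>.  The truncated exponent
  \<open>min 1 \<gamma>\<close> serves two purposes.  Both signals, \<open>t / 2\<close> for \<open>Q\<close> and \<open>C\<gamma> * (t / 2) powr \<gamma>\<close> for \<open>P\<close> in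
  the units \<open>\<delta>\<close> and \<open>\<delta> powr \<gamma>\<close>, are at least \<open>c0 * \<tau>\<close>.  And the scaled parameters \<open>s * \<delta>\<close> and
  \<open>s * \<delta> powr \<gamma>\<close> remain bounded by \<open>4 * c0\<close>, so that one choice of the radius serves all \<open>x\<close>.
\<close>
lemma misclassification_decay:
  fixes P Q :: "((real ^ 'd) \<times> bool) measure" and x :: "real ^ 'd" and c0 :: real
  defines "v \<equiv> unit_ball_vol (real CARD('d))" and "\<Omega> \<equiv> measure_support (X_marginal Q)"
  assumes PQ: "(P, Q, \<eta>P, \<eta>Q) \<in> param_space \<alpha> C\<alpha> \<beta> C\<beta> \<gamma> C\<gamma> \<mu>m \<mu>p c\<mu> r\<mu>"
    and pos: "0 < \<beta>" "C\<beta> > 0" "\<gamma> > 0" "C\<gamma> > 0" "0 < \<mu>m"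
    and c0: "0 < c0" "c0 \<le> 1/2" "c0 \<le> C\<gamma> * (1/2) powr \<gamma>"
    and k: "kP \<le> nP" "kQ \<le> nQ"
    and r: "0 < r" "r \<le> r\<mu>" and \<rho>: "2 * (1 + 4 * c0) * \<rho> \<le> \<mu>m * c\<mu> * v * r ^ CARD('d)"
    and k\<rho>: "real kP \<le> real nP * \<rho>" "real kQ \<le> real nQ * \<rho>"
    and S: "S \<le> real kP * \<delta> powr (2 * \<gamma>) + real kQ * \<delta>\<^sup>2"
    and \<delta>: "0 < \<delta>" "\<delta> \<le> \<bar>\<eta>Q x - 1/2\<bar>" and r\<Delta>: "C\<beta> * r powr \<beta> \<le> \<bar>\<eta>Q x - 1/2\<bar> / 2"
    and x: "x \<in> \<Omega>"
  shows "(\<integral>\<^sup>+D. of_bool (classifier_NN nP nQ (\<delta> powr \<gamma>) \<delta> kP kQ (fst D) (snd D) x \<noteq> bayes_classifier \<eta>Q x)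
           \<partial>data_distribution P nP Q nQ)
     \<le> ennreal (4 * exp (- (2 * c0\<^sup>2 * S * (\<bar>\<eta>Q x - 1/2\<bar> / \<delta>) powr (2 * min 1 \<gamma>))))"
proof -
  have P: "prob_space P" "sets P = sets labelled_space" and Q: "prob_space Q" "sets Q = sets labelled_space"
    and regP: "regression_function P \<eta>P" and regQ: "regression_function Q \<eta>Q"
    and rse: "relative_signal_exponent P Q \<eta>P \<eta>Q \<gamma> C\<gamma>"
    and smooth: "smoothness Q \<eta>Q \<beta> C\<beta>" and csd: "common_support_strong_density P Q \<mu>m \<mu>p c\<mu> r\<mu>"
    using PQ unfolding param_space_def labelled_distribution_def by auto
  have \<Omega>P: "measure_support (X_marginal P) = \<Omega>"
    and dens: "density_between P \<mu>m \<mu>p" "density_between Q \<mu>m \<mu>p"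
    and vol: "\<And>y r. y \<in> \<Omega> \<Longrightarrow> 0 < r \<Longrightarrow> r \<le> r\<mu> \<Longrightarrow> c\<mu> * measure lborel (ball y r) \<le> measure lborel (\<Omega> \<inter> ball y r)"
    using csd unfolding common_support_strong_density_def \<Omega>_def Let_def by auto
  have rng: "\<And>x. 0 \<le> \<eta>P x" "\<And>x. \<eta>P x \<le> 1" "\<And>x. 0 \<le> \<eta>Q x" "\<And>x. \<eta>Q x \<le> 1"
    using regP regQ unfolding regression_function_def by auto
  define \<Delta> where "\<Delta> = \<bar>\<eta>Q x - 1/2\<bar>"
  define t where "t = \<Delta> / \<delta>"
  define \<tau> where "\<tau> = t powr (min 1 \<gamma>)"
  define s where "s = 4 * c0 * \<tau>"
  define b where "b = bayes_classifier \<eta>Q x"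
  define p where "p = \<mu>m * c\<mu> * v * r ^ CARD('d)"
  have \<Delta>: "\<Delta> > 0" "\<Delta> \<le> 1/2" "\<delta> \<le> \<Delta>" using \<delta> rng(3,4)[of x] unfolding \<Delta>_def by linarith+
  have t: "t \<ge> 1" using \<Delta> \<delta> by (simp add: t_def)
  have \<tau>: "1 \<le> \<tau>" "\<tau> \<le> t" "\<tau> \<le> t powr \<gamma>"
    using t pos powr_mono[of "min 1 \<gamma>" 1 t] powr_mono[of "min 1 \<gamma>" \<gamma> t]
    by (auto simp: \<tau>_def intro: ge_one_powr_ge_zero)
  have s0: "s \<ge> 0" using c0 \<tau> by (simp add: s_def)
  have t\<delta>: "t * \<delta> = \<Delta>" using \<delta> by (simp add: t_def)
  have t\<delta>\<gamma>: "t powr \<gamma> * \<delta> powr \<gamma> = \<Delta> powr \<gamma>" using \<delta> t t\<delta> by (simp flip: powr_mult)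
  have uQ: "s * \<delta> \<le> 4 * c0"
  proof -
    have "\<tau> * \<delta> \<le> t * \<delta>" using \<tau> \<delta> by (intro mult_right_mono) auto
    also have "\<dots> \<le> 1" using t\<delta> \<Delta> by simp
    finally show ?thesis using c0 mult_left_mono[of "\<tau> * \<delta>" 1 "4 * c0"] by (simp add: s_def mult_ac)
  qed
  have uP: "s * \<delta> powr \<gamma> \<le> 4 * c0"
  proof -
    have "\<tau> * \<delta> powr \<gamma> \<le> t powr \<gamma> * \<delta> powr \<gamma>" using \<tau> \<delta> by (intro mult_right_mono) auto
    also have "\<dots> \<le> 1" unfolding t\<delta>\<gamma> using \<Delta> pos powr_mono2[of \<gamma> \<Delta> 1] by simp
    finally show ?thesis using c0 mult_left_mono[of "\<tau> * \<delta> powr \<gamma>" 1 "4 * c0"] by (simp add: s_def mult_ac)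
  qed
  have biasQ: "1/2 + \<Delta> / 2 \<le> (if b then \<eta>Q x' else 1 - \<eta>Q x')"
    if x': "x' \<in> \<Omega>" "dist x x' < r" for x'
  proof -
    have "\<bar>\<eta>Q x - \<eta>Q x'\<bar> \<le> C\<beta> * norm (x - x') powr \<beta>"
      using smooth x x' unfolding smoothness_def \<Omega>_def by blast
    also have "\<dots> \<le> C\<beta> * r powr \<beta>"
      using x' pos by (intro mult_left_mono powr_mono2) (auto simp: dist_norm)
    also have "\<dots> \<le> \<Delta> / 2" using r\<Delta> by (simp add: \<Delta>_def)
    finally have "\<bar>\<eta>Q x - \<eta>Q x'\<bar> \<le> \<Delta> / 2" .
    hence d: "\<eta>Q x - \<eta>Q x' \<le> \<Delta> / 2" "\<eta>Q x' - \<eta>Q x \<le> \<Delta> / 2" by linarith+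
    show ?thesis
    proof (cases b)
      case True
      hence "\<eta>Q x = 1/2 + \<Delta>" by (simp add: b_def bayes_classifier_def \<Delta>_def)
      hence "1/2 + \<Delta> / 2 \<le> \<eta>Q x'" using d by linarith
      thus ?thesis using True by simp
    next
      case False
      hence "\<eta>Q x = 1/2 - \<Delta>" by (simp add: b_def bayes_classifier_def \<Delta>_def)
      hence "1/2 + \<Delta> / 2 \<le> 1 - \<eta>Q x'" using d by linarith
      thus ?thesis using False by simp
    qed
  qed
  have signal: "0 \<le> (\<eta>P y - 1/2) * (\<eta>Q y - 1/2)" "C\<gamma> * \<bar>\<eta>Q y - 1/2\<bar> powr \<gamma> \<le> \<bar>\<eta>P y - 1/2\<bar>"
    if "y \<in> \<Omega>" for y
    using rse that unfolding relative_signal_exponent_def \<Omega>_def by blast+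
  have biasP: "1/2 + C\<gamma> * (\<Delta> / 2) powr \<gamma> \<le> (if b then \<eta>P x' else 1 - \<eta>P x')"
    if x': "x' \<in> \<Omega>" "dist x x' < r" for x'
  proof -
    have q: "\<Delta> / 2 \<le> (if b then \<eta>Q x' - 1/2 else 1/2 - \<eta>Q x')" using biasQ[OF x'] by (auto split: if_splits)
    hence q': "\<Delta> / 2 \<le> \<bar>\<eta>Q x' - 1/2\<bar>"
      using abs_ge_self[of "\<eta>Q x' - 1/2"] abs_ge_minus_self[of "\<eta>Q x' - 1/2"] by (cases b) simp_all
    have "C\<gamma> * (\<Delta> / 2) powr \<gamma> \<le> C\<gamma> * \<bar>\<eta>Q x' - 1/2\<bar> powr \<gamma>"
      using q' pos \<Delta> by (intro mult_left_mono powr_mono2) auto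
    also have "\<dots> \<le> \<bar>\<eta>P x' - 1/2\<bar>" by (rule signal(2)[OF x'(1)])
    finally have "C\<gamma> * (\<Delta> / 2) powr \<gamma> \<le> \<bar>\<eta>P x' - 1/2\<bar>" .
    moreover have "if b then 0 \<le> \<eta>P x' - 1/2 else \<eta>P x' - 1/2 \<le> 0"
      using signal(1)[OF x'(1)] q \<Delta>(1) by (auto simp: zero_le_mult_iff split: if_splits)
    ultimately show ?thesis by (cases b) simp_all
  qed
  \<comment> \<open>Apply the bias bound at \<open>x\<close> itself, where the regression function is at most 1.\<close>
  have aP: "C\<gamma> * (\<Delta> / 2) powr \<gamma> \<le> 1/2"
    using biasP[OF x] r rng(1,2)[of x] by (auto split: if_splits)
  have AEP: "AE z in P. fst z \<in> \<Omega>" and AEQ: "AE z in Q. fst z \<in> \<Omega>"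
  proof -
    have "fst \<in> measurable P (borel :: (real^'d) measure)" "fst \<in> measurable Q (borel :: (real^'d) measure)"
      by (simp_all cong: measurable_cong_sets add: P Q)
    moreover have "AE y in X_marginal P. y \<in> \<Omega>" "AE y in X_marginal Q. y \<in> \<Omega>"
      using AE_in_measure_support[of "X_marginal P"] AE_in_measure_support[of "X_marginal Q"] \<Omega>P
      by (auto simp: X_marginal_def \<Omega>_def)
    ultimately show "AE z in P. fst z \<in> \<Omega>" "AE z in Q. fst z \<in> \<Omega>"
      unfolding X_marginal_def by (auto dest: AE_distrD)
  qed
  have mP: "p \<le> measure P {z \<in> space P. dist x (fst z) < r}"
    unfolding p_def v_def
    by (rule ball_mass_ge[OF P dens(1) pos(5)]) (use vol[OF x r] r \<Omega>P in auto)
  have mQ: "p \<le> measure Q {z \<in> space Q. dist x (fst z) < r}"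
    unfolding p_def v_def
    by (rule ball_mass_ge[OF Q dens(2) pos(5)]) (use vol[OF x r] r \<Omega>_def in auto)
  have np: "2 * (1 + u) * real k \<le> real n * p" if "u \<le> 4 * c0" "real k \<le> real n * \<rho>" for u k n
  proof -
    have "2 * (1 + u) * real k \<le> 2 * (1 + 4 * c0) * real k" using that by (intro mult_right_mono) auto
    also have "\<dots> \<le> 2 * (1 + 4 * c0) * (real n * \<rho>)" using that c0 by (intro mult_left_mono) auto
    also have "\<dots> = real n * (2 * (1 + 4 * c0) * \<rho>)" by simp
    also have "\<dots> \<le> real n * p" using \<rho> unfolding p_def by (intro mult_left_mono) auto
    finally show ?thesis .
  qed
  define EP where "EP = real kP * (- (s * \<delta> powr \<gamma>) * (C\<gamma> * (\<Delta> / 2) powr \<gamma>) + (s * \<delta> powr \<gamma>)\<^sup>2 / 8)"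
  define EQ where "EQ = real kQ * (- (s * \<delta>) * (\<Delta> / 2) + (s * \<delta>)\<^sup>2 / 8)"
  have "(\<integral>\<^sup>+D. of_bool (classifier_NN nP nQ (\<delta> powr \<gamma>) \<delta> kP kQ (fst D) (snd D) x \<noteq> b)
           \<partial>data_distribution P nP Q nQ) \<le> ennreal ((2 * exp EP) * (2 * exp EQ))"
  proof (rule misclassification_probability[OF P Q k _ _ s0])
    show "(\<integral>\<^sup>+D. ennreal (exp (- (s * \<delta> powr \<gamma>) * (\<Sum>i<kP. of_bool (snd (nearest D nP x i) = b) - 1/2)))
            \<partial>PiM {..<nP} (\<lambda>_. P)) \<le> ennreal (2 * exp EP)"
      unfolding EP_def
      by (rule nearest_votes_mgf[OF P regP AEP biasP aP _ mP np[OF uP k\<rho>(1)]]) (use s0 in auto)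
    show "(\<integral>\<^sup>+D. ennreal (exp (- (s * \<delta>) * (\<Sum>i<kQ. of_bool (snd (nearest D nQ x i) = b) - 1/2)))
            \<partial>PiM {..<nQ} (\<lambda>_. Q)) \<le> ennreal (2 * exp EQ)"
      unfolding EQ_def
      by (rule nearest_votes_mgf[OF Q regQ AEQ biasQ _ _ mQ np[OF uQ k\<rho>(2)]]) (use s0 \<delta> \<Delta> in auto)
  qed (use \<delta> in auto)
  also have "(2 * exp EP) * (2 * exp EQ) = 4 * exp (EP + EQ)" by (simp add: exp_add)
  also have "ennreal (4 * exp (EP + EQ)) \<le> ennreal (4 * exp (- (2 * c0\<^sup>2 * S * t powr (2 * min 1 \<gamma>))))"
  proof (intro ennreal_leI mult_left_mono)
    have sg: "s * y \<ge> s * (c0 * \<tau>)" if "y \<ge> c0 * \<tau>" for y using that s0 by (rule mult_left_mono)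
    \<comment> \<open>\<open>s = 4 * c0 * \<tau>\<close> minimises this quadratic.\<close>
    have quad: "- (s * (c0 * \<tau>)) + s\<^sup>2 / 8 = - (2 * c0\<^sup>2 * \<tau>\<^sup>2)"
      by (simp add: s_def power2_eq_square)
    have "EP = real kP * \<delta> powr (2 * \<gamma>) * (- (s * (C\<gamma> * (1/2) powr \<gamma> * t powr \<gamma>)) + s\<^sup>2 / 8)"
    proof -
      have "(\<Delta> / 2) powr \<gamma> = (1/2) powr \<gamma> * t powr \<gamma> * \<delta> powr \<gamma>"
        using t \<delta> unfolding t\<delta>[symmetric] by (simp add: powr_mult powr_divide)
      moreover have "\<delta> powr (2 * \<gamma>) = \<delta> powr \<gamma> * \<delta> powr \<gamma>" by (simp flip: powr_add)
      ultimately show ?thesis unfolding EP_def by (simp add: power2_eq_square algebra_simps)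
    qed
    also have "\<dots> \<le> real kP * \<delta> powr (2 * \<gamma>) * (- (2 * c0\<^sup>2 * \<tau>\<^sup>2))"
    proof (intro mult_left_mono)
      have "c0 * \<tau> \<le> C\<gamma> * (1/2) powr \<gamma> * t powr \<gamma>" using c0 \<tau> by (intro mult_mono) auto
      from sg[OF this] show "- (s * (C\<gamma> * (1/2) powr \<gamma> * t powr \<gamma>)) + s\<^sup>2 / 8 \<le> - (2 * c0\<^sup>2 * \<tau>\<^sup>2)"
        using quad by linarith
    qed auto
    finally have EP: "EP \<le> real kP * \<delta> powr (2 * \<gamma>) * (- (2 * c0\<^sup>2 * \<tau>\<^sup>2))" .
    have "EQ = real kQ * \<delta>\<^sup>2 * (- (s * (1/2 * t)) + s\<^sup>2 / 8)"
      unfolding EQ_def t\<delta>[symmetric] by (simp add: power2_eq_square algebra_simps)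
    also have "\<dots> \<le> real kQ * \<delta>\<^sup>2 * (- (2 * c0\<^sup>2 * \<tau>\<^sup>2))"
    proof (intro mult_left_mono)
      have "c0 * \<tau> \<le> 1/2 * t" using c0 \<tau> by (intro mult_mono) auto
      from sg[OF this] show "- (s * (1/2 * t)) + s\<^sup>2 / 8 \<le> - (2 * c0\<^sup>2 * \<tau>\<^sup>2)"
        using quad by linarith
    qed auto
    finally have "EP + EQ \<le> (real kP * \<delta> powr (2 * \<gamma>) + real kQ * \<delta>\<^sup>2) * (- (2 * c0\<^sup>2 * \<tau>\<^sup>2))"
      using EP by (simp add: algebra_simps)
    also have "\<dots> \<le> S * (- (2 * c0\<^sup>2 * \<tau>\<^sup>2))"
      using S by (intro mult_right_mono_neg) auto
    also have "\<tau>\<^sup>2 = t powr (2 * min 1 \<gamma>)" using t unfolding \<tau>_def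
      by (simp add: power2_eq_square flip: powr_add)
    finally show "exp (EP + EQ) \<le> exp (- (2 * c0\<^sup>2 * S * t powr (2 * min 1 \<gamma>)))" by (simp add: mult_ac)
  qed auto
  finally show ?thesis unfolding b_def t_def \<Delta>_def .
qed

section \<open>Calibration of weights and neighbour numbers\<close>

text \<open>
  This follows from \<open>(1 + y / n) ^ n \<le> exp y\<close> at \<open>y = c * t powr \<kappa>\<close>, with \<open>n\<close> so large that
  \<open>n * \<kappa> \<ge> m\<close>.
\<close>
lemma exp_neg_powr_le:
  fixes c \<kappa> m :: real
  assumes "c > 0" "\<kappa> > 0"
  obtains K where "K > 0" "\<And>t. t \<ge> 1 \<Longrightarrow> exp (- (c * t powr \<kappa>)) \<le> K * t powr (- m)"
proof -
  define n where "n = nat \<lceil>max 1 (m / \<kappa>)\<rceil>"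
  have n: "real n \<ge> m / \<kappa>" "n > 0" unfolding n_def by linarith+
  have n': "real n * \<kappa> \<ge> m" using n assms by (simp add: field_simps)
  show ?thesis
  proof (rule that[of "(real n / c) ^ n"])
    show "(real n / c) ^ n > 0" using n assms by simp
    fix t :: real assume t: "t \<ge> 1"
    have "(c / real n) ^ n * t powr m \<le> (c / real n) ^ n * t powr (real n * \<kappa>)"
      using t n' assms by (intro mult_left_mono powr_mono) auto
    also have "t powr (real n * \<kappa>) = (t powr \<kappa>) ^ n"
      using t by (simp add: powr_powr mult.commute flip: powr_realpow)
    also have "(c / real n) ^ n * (t powr \<kappa>) ^ n = (c * t powr \<kappa> / real n) ^ n"
      by (simp flip: power_mult_distrib)
    also have "\<dots> \<le> (1 + c * t powr \<kappa> / real n) ^ n"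
      using assms t by (intro power_mono) auto
    also have "\<dots> \<le> exp (c * t powr \<kappa>)"
      using n assms by (intro exp_ge_one_plus_x_over_n_power_n) (auto intro: order_trans[of _ 0])
    finally have "(c / real n) ^ n * t powr m \<le> exp (c * t powr \<kappa>)" .
    thus "exp (- (c * t powr \<kappa>)) \<le> (real n / c) ^ n * t powr (- m)"
      using t assms n by (simp add: exp_minus powr_minus field_simps power_divide)
  qed
qed

text \<open>
  The lower bound on \<open>N\<close> ensures \<open>y \<ge> 1\<close>, and then taking the floor loses at most a factor 2.
\<close>
lemma floor_growth:
  fixes c \<theta> N y :: real
  assumes "c > 0" "\<theta> > 0" "N \<ge> 1" "(1 / c) powr (1 / \<theta>) \<le> N" "c * N powr \<theta> \<le> y"
  shows "c / 2 \<le> real (nat \<lfloor>y\<rfloor>) * N powr (- \<theta>)"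
proof -
  have "1 / c = ((1 / c) powr (1 / \<theta>)) powr \<theta>" using assms by (simp add: powr_powr)
  also have "\<dots> \<le> N powr \<theta>" using assms by (intro powr_mono2) auto
  finally have "1 \<le> c * N powr \<theta>" using assms by (simp add: field_simps)
  hence "y \<ge> 1" using assms by linarith
  hence f1: "1 \<le> \<lfloor>y\<rfloor>" by (simp add: le_floor_iff)
  have "real (nat \<lfloor>y\<rfloor>) = of_int \<lfloor>y\<rfloor>" using f1 by (intro of_nat_nat) linarith
  moreover have "1 \<le> real_of_int \<lfloor>y\<rfloor>" using f1 by linarith
  moreover have "y < of_int \<lfloor>y\<rfloor> + 1" by simp
  ultimately have "y / 2 \<le> real (nat \<lfloor>y\<rfloor>)" by linarith
  hence "c * N powr \<theta> / 2 \<le> real (nat \<lfloor>y\<rfloor>)" using assms by linarith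
  hence "c * N powr \<theta> / 2 * N powr (- \<theta>) \<le> real (nat \<lfloor>y\<rfloor>) * N powr (- \<theta>)"
    by (intro mult_right_mono) auto
  moreover have "N powr \<theta> * N powr (- \<theta>) = 1" using assms by (simp flip: powr_add)
  hence "c * N powr \<theta> / 2 * N powr (- \<theta>) = c / 2" by (simp add: mult.assoc)
  ultimately show ?thesis by linarith
qed

text \<open>
  One of the two summands of \<open>N\<close> is at least \<open>N / 2\<close>.  If it is \<open>nQ\<close>, then
  \<open>nQ * N powr (- d / e)\<close> is of order \<open>N powr (2 * \<beta> / e)\<close>, where \<open>e = 2 * \<beta> + d\<close>, which the squared
  weight cancels.  If it is the other one, then \<open>nP\<close> is of order \<open>N powr (e' / e)\<close> with
  \<open>e' = 2 * \<gamma> * \<beta> + d\<close>, and \<open>nP * N powr (- d / e)\<close> is of order \<open>N powr (2 * \<gamma> * \<beta> / e)\<close>, which again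
  is the inverse of the squared weight.
\<close>
lemma effective_sample_size:
  fixes \<beta> \<gamma> d :: real
  assumes "\<beta> > 0" "\<gamma> > 0" "d > 0"
  obtains S N0 where "S > 0" "\<And>nP nQ N. N = real nP powr ((2 * \<beta> + d) / (2 * \<gamma> * \<beta> + d)) + real nQ \<Longrightarrow>
      N \<ge> 1 \<Longrightarrow> N \<ge> N0 \<Longrightarrow>
      S \<le> real (nat \<lfloor>real nP * N powr (- d / (2 * \<beta> + d))\<rfloor>) * (N powr (- \<beta> / (2 * \<beta> + d))) powr (2 * \<gamma>) +
          real (nat \<lfloor>real nQ * N powr (- d / (2 * \<beta> + d))\<rfloor>) * (N powr (- \<beta> / (2 * \<beta> + d)))\<^sup>2"
proof -
  define e where "e = 2 * \<beta> + d"
  define e' where "e' = 2 * \<gamma> * \<beta> + d"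
  have e: "e > 0" "e' > 0" using assms by (auto simp: e_def e'_def intro: add_pos_pos)
  define cQ where "cQ = (1/2 :: real)"
  define cP where "cP = (1/2 :: real) powr (e' / e)"
  define \<theta>Q where "\<theta>Q = 2 * \<beta> / e"
  define \<theta>P where "\<theta>P = 2 * \<gamma> * \<beta> / e"
  have \<theta>: "\<theta>Q > 0" "\<theta>P > 0" using assms e by (auto simp: \<theta>Q_def \<theta>P_def)
  have c: "cQ > 0" "cP > 0" by (auto simp: cQ_def cP_def)
  show ?thesis
  proof (rule that[of "min (cQ / 2) (cP / 2)" "max ((1 / cQ) powr (1 / \<theta>Q)) ((1 / cP) powr (1 / \<theta>P))"])
    show "min (cQ / 2) (cP / 2) > 0" using c by simp
    fix nP nQ :: nat and N :: real
    assume N: "N = real nP powr ((2 * \<beta> + d) / (2 * \<gamma> * \<beta> + d)) + real nQ" "N \<ge> 1"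
      and N0: "N \<ge> max ((1 / cQ) powr (1 / \<theta>Q)) ((1 / cP) powr (1 / \<theta>P))"
    have pw: "(N powr (- \<beta> / e)) powr (2 * \<gamma>) = N powr (- \<theta>P)" "(N powr (- \<beta> / e))\<^sup>2 = N powr (- \<theta>Q)"
      using N(2) by (auto simp: powr_powr power2_eq_square \<theta>P_def \<theta>Q_def mult_ac simp flip: powr_add)
    let ?kP = "real (nat \<lfloor>real nP * N powr (- d / e)\<rfloor>)" and ?kQ = "real (nat \<lfloor>real nQ * N powr (- d / e)\<rfloor>)"
    have "min (cQ / 2) (cP / 2) \<le> ?kP * N powr (- \<theta>P) + ?kQ * N powr (- \<theta>Q)"
    proof (cases "N / 2 \<le> real nQ")
      case True
      have "cQ * N powr \<theta>Q = N powr 1 / 2 * N powr (- d / e)"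
      proof -
        have "1 + - d / e = \<theta>Q" using e by (simp add: \<theta>Q_def e_def field_simps)
        hence "N powr \<theta>Q = N powr 1 * N powr (- d / e)" by (simp only: powr_add[symmetric])
        thus ?thesis by (simp add: cQ_def)
      qed
      also have "\<dots> \<le> real nQ * N powr (- d / e)"
        using True N(2) by (intro mult_right_mono) auto
      finally have "cQ / 2 \<le> ?kQ * N powr (- \<theta>Q)"
        using c \<theta> N(2) N0 by (intro floor_growth) auto
      moreover have "0 \<le> ?kP * N powr (- \<theta>P)" by simp
      ultimately show ?thesis by linarith
    next
      case False
      have "(N / 2) powr (e' / e) \<le> (real nP powr (e / e')) powr (e' / e)"
        using False N e unfolding e_def e'_def by (intro powr_mono2) auto
      also have "\<dots> = real nP" using e by (simp add: powr_powr)
      finally have nP: "(N / 2) powr (e' / e) \<le> real nP" .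
      have "cP * N powr \<theta>P = (N / 2) powr (e' / e) * N powr (- d / e)"
      proof -
        have "e' / e + - d / e = \<theta>P" using e by (simp add: \<theta>P_def e'_def field_simps)
        hence "N powr \<theta>P = N powr (e' / e) * N powr (- d / e)" by (simp only: powr_add[symmetric])
        moreover have "(N / 2) powr (e' / e) = N powr (e' / e) * cP"
          using N(2) by (simp add: cP_def powr_divide)
        ultimately show ?thesis by simp
      qed
      also have "\<dots> \<le> real nP * N powr (- d / e)"
        using nP by (intro mult_right_mono) auto
      finally have "cP / 2 \<le> ?kP * N powr (- \<theta>P)"
        using c \<theta> N(2) N0 by (intro floor_growth) auto
      moreover have "0 \<le> ?kQ * N powr (- \<theta>Q)" by simp
      ultimately show ?thesis by linarith
    qed
    thus "min (cQ / 2) (cP / 2) \<le> real (nat \<lfloor>real nP * N powr (- d / (2 * \<beta> + d))\<rfloor>) * (N powr (- \<beta> / (2 * \<beta> + d))) powr (2 * \<gamma>) +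
          real (nat \<lfloor>real nQ * N powr (- d / (2 * \<beta> + d))\<rfloor>) * (N powr (- \<beta> / (2 * \<beta> + d)))\<^sup>2"
      unfolding e_def[symmetric] pw .
  qed
qed

section \<open>The rate of convergence\<close>

theorem theorem3p1:
  fixes \<alpha> C\<alpha> \<beta> C\<beta> \<gamma> C\<gamma> \<mu>m \<mu>p c\<mu> r\<mu> d :: real
  defines "d \<equiv> real CARD('d::finite)"
  assumes "\<alpha> \<ge> 0" "C\<alpha> > 0"
    and "0 < \<beta>" "\<beta> \<le> 1" "C\<beta> > 0"
    and "\<gamma> > 0" "C\<gamma> > 0"
    and "0 < \<mu>m" "\<mu>m < \<mu>p"
    and "c\<mu> > 0" "r\<mu> > 0"
    and "\<alpha> * \<beta> \<le> d"
  shows "\<exists>C>0. \<forall>nP nQ :: nat. nP + nQ \<ge> 1 \<longrightarrow>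
    (let N = real nP powr ((2 * \<beta> + d) / (2 * \<gamma> * \<beta> + d)) + real nQ;
         wQ = N powr (- \<beta> / (2 * \<beta> + d));
         wP = N powr (- (\<gamma> * \<beta>) / (2 * \<beta> + d));
         kQ = nat \<lfloor>real nQ * N powr (- d / (2 * \<beta> + d))\<rfloor>;
         kP = nat \<lfloor>real nP * N powr (- d / (2 * \<beta> + d))\<rfloor>
     in (SUP (P, Q, \<eta>P, \<eta>Q) \<in>
             (param_space \<alpha> C\<alpha> \<beta> C\<beta> \<gamma> C\<gamma> \<mu>m \<mu>p c\<mu> r\<mu> ::
               (((real ^ 'd) \<times> bool) measure \<times> ((real ^ 'd) \<times> bool) measure \<times>
                (real ^ 'd \<Rightarrow> real) \<times> (real ^ 'd \<Rightarrow> real)) set).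
           ereal (expected_excess_risk_NN nP nQ wP wQ kP kQ P Q \<eta>Q))
        \<le> ereal (C * N powr (- (\<beta> * (1 + \<alpha>)) / (2 * \<beta> + d))))"
proof -
  have d: "d \<ge> 1" unfolding d_def using one_le_card_finite[where 'a = 'd] by linarith
  define e where "e = 2 * \<beta> + d"
  have e: "e > 0" using d assms by (simp add: e_def)
  define c0 where "c0 = min (1/2) (C\<gamma> * (1/2) powr \<gamma>)"
  have c0: "0 < c0" "c0 \<le> 1/2" "c0 \<le> C\<gamma> * (1/2) powr \<gamma>" using assms by (auto simp: c0_def)
  define v where "v = unit_ball_vol d"
  have v: "v > 0" using d by (simp add: v_def unit_ball_vol_def Gamma_real_pos)
  \<comment> \<open>The radius constant: a ball of radius \<open>R * N powr (- 1 / e)\<close> must have expected content at least \<open>2 * (1 + 4 * c0) * k\<close> in either sample.\<close>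
  define R where "R = max 1 (2 * (1 + 4 * c0) / (\<mu>m * c\<mu> * v))"
  have R: "R \<ge> 1" "2 * (1 + 4 * c0) \<le> \<mu>m * c\<mu> * v * R ^ CARD('d)"
  proof -
    show R1: "R \<ge> 1" by (simp add: R_def)
    have "2 * (1 + 4 * c0) / (\<mu>m * c\<mu> * v) \<le> R" by (simp add: R_def)
    also have "R \<le> R ^ CARD('d)" using R1 by (intro self_le_power) auto
    finally show "2 * (1 + 4 * c0) \<le> \<mu>m * c\<mu> * v * R ^ CARD('d)"
      using v assms by (simp add: field_simps)
  qed
  \<comment> \<open>Beyond \<open>t0 * \<delta>\<close> the margin is at least twice the oscillation of \<open>\<eta>Q\<close> on such a ball.\<close>
  define t0 where "t0 = max 1 (2 * C\<beta> * R powr \<beta>)"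
  obtain S N1 where S: "S > 0" and NS: "\<And>nP nQ N. N = real nP powr ((2 * \<beta> + d) / (2 * \<gamma> * \<beta> + d)) + real nQ \<Longrightarrow>
      N \<ge> 1 \<Longrightarrow> N \<ge> N1 \<Longrightarrow>
      S \<le> real (nat \<lfloor>real nP * N powr (- d / (2 * \<beta> + d))\<rfloor>) * (N powr (- \<beta> / (2 * \<beta> + d))) powr (2 * \<gamma>) +
          real (nat \<lfloor>real nQ * N powr (- d / (2 * \<beta> + d))\<rfloor>) * (N powr (- \<beta> / (2 * \<beta> + d)))\<^sup>2"
  proof (rule effective_sample_size)
    show "\<beta> > 0" "\<gamma> > 0" "d > 0" using assms d by auto
  qed (rule that)
  define \<kappa> where "\<kappa> = 2 * min 1 \<gamma>"
  obtain K' where K': "K' > 0" "\<And>t. t \<ge> 1 \<Longrightarrow> exp (- (2 * c0\<^sup>2 * S * t powr \<kappa>)) \<le> K' * t powr (- (\<alpha> + 2))"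
  proof (rule exp_neg_powr_le)
    show "2 * c0\<^sup>2 * S > 0" "\<kappa> > 0" using c0 S assms by (auto simp: \<kappa>_def)
  qed (rule that)
  \<comment> \<open>The second entry makes the polynomial bound trivial below \<open>t0 * \<delta>\<close>.\<close>
  define K where "K = max (4 * K') (t0 powr (\<alpha> + 2))"
  have K: "K \<ge> 1" "4 * K' \<le> K" "t0 powr (\<alpha> + 2) \<le> K"
    using ge_one_powr_ge_zero[of t0 "\<alpha> + 2"] assms by (auto simp: K_def t0_def)
  \<comment> \<open>From \<open>N0\<close> on, the radius is at most \<open>r\<mu>\<close> and the effective sample size is at least \<open>S\<close>.\<close>
  define N0 where "N0 = max 1 (max N1 ((R / r\<mu>) powr e))"
  define C where "C = max (2 * (K * 2 powr (\<alpha> + 2) * C\<alpha>)) (N0 powr (\<beta> * (1 + \<alpha>) / e))"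
  have "N0 powr (\<beta> * (1 + \<alpha>) / e) > 0" by (simp add: N0_def)
  hence C: "C > 0" by (simp add: C_def less_max_iff_disj)
  have main: "expected_excess_risk_NN nP nQ (N powr (- (\<gamma> * \<beta>) / e)) (N powr (- \<beta> / e)) kP kQ P Q \<eta>Q
      \<le> C * N powr (- (\<beta> * (1 + \<alpha>)) / e)"
    if n: "nP + nQ \<ge> 1" and N: "N = real nP powr ((2 * \<beta> + d) / (2 * \<gamma> * \<beta> + d)) + real nQ"
      and kQ: "kQ = nat \<lfloor>real nQ * N powr (- d / e)\<rfloor>" and kP: "kP = nat \<lfloor>real nP * N powr (- d / e)\<rfloor>"
      and PQ: "(P, Q, \<eta>P, \<eta>Q) \<in> param_space \<alpha> C\<alpha> \<beta> C\<beta> \<gamma> C\<gamma> \<mu>m \<mu>p c\<mu> r\<mu>"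
    for nP nQ N kP kQ and P Q :: "((real ^ 'd) \<times> bool) measure" and \<eta>P \<eta>Q
  proof -
    have P: "prob_space P" "sets P = sets labelled_space" and Q: "prob_space Q" "sets Q = sets labelled_space"
      and regQ: "regression_function Q \<eta>Q" and margin: "margin_condition Q \<eta>Q \<alpha> C\<alpha>"
      using PQ by (simp_all add: param_space_def labelled_distribution_def)
    have rng: "\<And>x. 0 \<le> \<eta>Q x" "\<And>x. \<eta>Q x \<le> 1" and [measurable]: "\<eta>Q \<in> borel_measurable borel"
      using regQ by (simp_all add: regression_function_def)
    have N1: "N \<ge> 1"
    proof (cases "nQ \<ge> 1")
      case True
      have "0 \<le> real nP powr ((2 * \<beta> + d) / (2 * \<gamma> * \<beta> + d))" by simp
      thus ?thesis using True N by linarith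
    next
      case False
      hence "real nP \<ge> 1" using n by simp
      hence "real nP powr ((2 * \<beta> + d) / (2 * \<gamma> * \<beta> + d)) \<ge> 1"
        using assms d by (intro ge_one_powr_ge_zero divide_nonneg_nonneg) auto
      thus ?thesis using N by linarith
    qed
    define \<delta> where "\<delta> = N powr (- \<beta> / e)"
    define \<rho> where "\<rho> = N powr (- d / e)"
    have \<delta>: "\<delta> > 0" using N1 by (simp add: \<delta>_def)
    have wP: "N powr (- (\<gamma> * \<beta>) / e) = \<delta> powr \<gamma>"
      using e by (simp add: \<delta>_def powr_powr field_simps)
    have rate: "N powr (- (\<beta> * (1 + \<alpha>)) / e) = \<delta> powr (1 + \<alpha>)"
    proof -
      have "- (\<beta> * (1 + \<alpha>)) / e = - \<beta> / e * (1 + \<alpha>)" by simp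
      thus ?thesis by (simp only: \<delta>_def powr_powr)
    qed
    have \<rho>: "0 \<le> \<rho>" "\<rho> \<le> 1" using N1 d e powr_mono[of "- d / e" 0 N] by (auto simp: \<rho>_def)
    have k\<rho>: "real kP \<le> real nP * \<rho>" "real kQ \<le> real nQ * \<rho>"
      using \<rho> by (auto simp: kP kQ \<rho>_def intro!: of_nat_floor)
    have k: "kP \<le> nP" "kQ \<le> nQ"
    proof -
      have "real n * \<rho> \<le> real n" for n using \<rho> mult_left_mono[of \<rho> 1 "real n"] by simp
      with k\<rho> have "real kP \<le> real nP" "real kQ \<le> real nQ" by (meson order_trans)+
      thus "kP \<le> nP" "kQ \<le> nQ" by simp_all
    qed
    let ?M = "X_marginal Q"
    interpret M: prob_space ?M unfolding X_marginal_def
      by (intro prob_space.prob_space_distr Q) (simp cong: measurable_cong_sets add: Q)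
    have sM[measurable_cong]: "sets ?M = sets borel" by (simp add: X_marginal_def)
    define q where "q x = (\<integral>\<^sup>+D. of_bool (classifier_NN nP nQ (\<delta> powr \<gamma>) \<delta> kP kQ (fst D) (snd D) x \<noteq> bayes_classifier \<eta>Q x)
              \<partial>data_distribution P nP Q nQ)" for x
    have q1: "q x \<le> 1" for x
    proof -
      interpret PP: prob_space "PiM {..<nP} (\<lambda>_. P)" by (intro prob_space_PiM P)
      interpret PQ: prob_space "PiM {..<nQ} (\<lambda>_. Q)" by (intro prob_space_PiM Q)
      interpret pp: pair_prob_space "PiM {..<nP} (\<lambda>_. P)" "PiM {..<nQ} (\<lambda>_. Q)" ..
      have "q x \<le> (\<integral>\<^sup>+D. 1 \<partial>data_distribution P nP Q nQ)"
        unfolding q_def by (intro nn_integral_mono) auto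
      also have "\<dots> = 1" unfolding data_distribution_def by (simp add: pp.emeasure_space_1)
      finally show ?thesis .
    qed
    show ?thesis
    proof (cases "N \<ge> N0")
      case False
      have "expected_excess_risk_NN nP nQ (\<delta> powr \<gamma>) \<delta> kP kQ P Q \<eta>Q \<le> 2 * (1/2)"
      proof (rule expected_excess_risk_NN_le[OF P Q regQ k], unfold q_def[symmetric])
        have "(\<integral>\<^sup>+x. ennreal \<bar>\<eta>Q x - 1/2\<bar> * q x \<partial>?M) \<le> (\<integral>\<^sup>+x. ennreal (1/2) * 1 \<partial>?M)"
        proof (intro nn_integral_mono mult_mono ennreal_leI q1)
          show "\<bar>\<eta>Q x - 1/2\<bar> \<le> 1/2" for x using rng[of x] unfolding abs_le_iff by linarith
        qed auto
        thus "(\<integral>\<^sup>+x. ennreal \<bar>\<eta>Q x - 1/2\<bar> * q x \<partial>?M) \<le> ennreal (1/2)"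
          by (simp add: M.emeasure_space_1)
      qed simp
      also have "2 * (1/2) = N powr (\<beta> * (1 + \<alpha>) / e) * N powr (- (\<beta> * (1 + \<alpha>)) / e)"
        using N1 by (simp flip: powr_add)
      also have "\<dots> \<le> C * N powr (- (\<beta> * (1 + \<alpha>)) / e)"
      proof (intro mult_right_mono)
        have "N powr (\<beta> * (1 + \<alpha>) / e) \<le> N0 powr (\<beta> * (1 + \<alpha>) / e)"
          using False N1 e assms by (intro powr_mono2) auto
        thus "N powr (\<beta> * (1 + \<alpha>) / e) \<le> C" by (simp add: C_def)
      qed simp
      finally show ?thesis unfolding wP \<delta>_def[symmetric] .
    next
      case True
      define r where "r = R * N powr (- 1 / e)"
      have r: "0 < r" "r \<le> r\<mu>"
      proof -
        show "0 < r" using R N1 by (simp add: r_def)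
        have "R / r\<mu> = ((R / r\<mu>) powr e) powr (1 / e)" using R assms e by (simp add: powr_powr)
        also have "\<dots> \<le> N powr (1 / e)" using True e by (intro powr_mono2) (auto simp: N0_def)
        finally have "R \<le> r\<mu> * N powr (1 / e)" using assms by (simp add: field_simps)
        hence "R * N powr (- 1 / e) \<le> r\<mu> * N powr (1 / e) * N powr (- 1 / e)" by (intro mult_right_mono) auto
        also have "\<dots> = r\<mu>" using N1 by (simp add: mult.assoc flip: powr_add)
        finally show "r \<le> r\<mu>" by (simp add: r_def)
      qed
      have "2 * (1 + 4 * c0) * \<rho> \<le> \<mu>m * c\<mu> * v * R ^ CARD('d) * \<rho>"
        using R \<rho> by (intro mult_right_mono) auto
      also have "R ^ CARD('d) * \<rho> = r ^ CARD('d)"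
        using N1 by (simp add: r_def \<rho>_def power_mult_distrib d_def powr_powr flip: powr_realpow)
      hence "\<mu>m * c\<mu> * v * R ^ CARD('d) * \<rho> = \<mu>m * c\<mu> * v * r ^ CARD('d)" by (simp add: mult.assoc)
      finally have mass: "2 * (1 + 4 * c0) * \<rho> \<le> \<mu>m * c\<mu> * v * r ^ CARD('d)" .
      have r\<beta>: "C\<beta> * r powr \<beta> = C\<beta> * R powr \<beta> * \<delta>"
        using R N1 by (simp add: r_def \<delta>_def powr_mult powr_powr)
      have Sle: "S \<le> real kP * \<delta> powr (2 * \<gamma>) + real kQ * \<delta>\<^sup>2"
        unfolding kP kQ \<delta>_def e_def by (rule NS[OF N N1]) (use True in \<open>simp add: N0_def\<close>)
      have qK: "q x \<le> ennreal (K * (\<delta> / \<bar>\<eta>Q x - 1/2\<bar>) powr (\<alpha> + 2))"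
        if x: "x \<in> measure_support ?M" and pos: "0 < \<bar>\<eta>Q x - 1/2\<bar>" for x
      proof -
        define \<Delta> where "\<Delta> = \<bar>\<eta>Q x - 1/2\<bar>"
        have \<Delta>: "\<Delta> > 0" using pos by (simp add: \<Delta>_def)
        have inv: "(\<delta> / \<Delta>) powr (\<alpha> + 2) = (\<Delta> / \<delta>) powr (- (\<alpha> + 2))"
          using inverse_powr[of "\<Delta> / \<delta>" "\<alpha> + 2"] unfolding powr_minus by simp
        show ?thesis
        proof (cases "t0 * \<delta> \<le> \<Delta>")
          case True
          have "\<delta> \<le> t0 * \<delta>" using \<delta> by (simp add: t0_def)
          hence \<delta>\<Delta>: "\<delta> \<le> \<Delta>" using True by linarith
          have "2 * C\<beta> * R powr \<beta> * \<delta> \<le> t0 * \<delta>" using \<delta> by (intro mult_right_mono) (auto simp: t0_def)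
          hence r\<Delta>: "C\<beta> * r powr \<beta> \<le> \<Delta> / 2" using True unfolding r\<beta> by linarith
          have "q x \<le> ennreal (4 * exp (- (2 * c0\<^sup>2 * S * (\<Delta> / \<delta>) powr \<kappa>)))"
            unfolding q_def \<kappa>_def \<Delta>_def
            by (rule misclassification_decay[OF PQ _ _ _ _ _ c0 k r mass[unfolded v_def d_def] k\<rho> Sle \<delta>
                   \<delta>\<Delta>[unfolded \<Delta>_def] r\<Delta>[unfolded \<Delta>_def] x]) (use assms in auto)
          also have "\<dots> \<le> ennreal (K * (\<Delta> / \<delta>) powr (- (\<alpha> + 2)))"
          proof (intro ennreal_leI)
            have "\<Delta> / \<delta> \<ge> 1" using \<delta>\<Delta> \<delta> by simp
            from K'(2)[OF this] have "4 * exp (- (2 * c0\<^sup>2 * S * (\<Delta> / \<delta>) powr \<kappa>)) \<le> 4 * K' * (\<Delta> / \<delta>) powr (- (\<alpha> + 2))"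
              by simp
            also have "\<dots> \<le> K * (\<Delta> / \<delta>) powr (- (\<alpha> + 2))" using K by (intro mult_right_mono) auto
            finally show "4 * exp (- (2 * c0\<^sup>2 * S * (\<Delta> / \<delta>) powr \<kappa>)) \<le> K * (\<Delta> / \<delta>) powr (- (\<alpha> + 2))" .
          qed
          finally show ?thesis unfolding inv[symmetric] unfolding \<Delta>_def .
        next
          case False
          have "t0 powr (\<alpha> + 2) * t0 powr (- (\<alpha> + 2)) = 1" by (simp add: t0_def flip: powr_add)
          moreover have "t0 powr (\<alpha> + 2) * t0 powr (- (\<alpha> + 2)) \<le> K * (\<Delta> / \<delta>) powr (- (\<alpha> + 2))"
            using K False \<Delta> \<delta> assms
            by (intro mult_mono powr_mono2') (auto simp: field_simps)
          ultimately have "1 \<le> ennreal (K * (\<Delta> / \<delta>) powr (- (\<alpha> + 2)))" by simp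
          with q1[of x] show ?thesis unfolding inv[symmetric] unfolding \<Delta>_def by (rule order_trans)
        qed
      qed
      have "expected_excess_risk_NN nP nQ (\<delta> powr \<gamma>) \<delta> kP kQ P Q \<eta>Q
         \<le> 2 * (K * 2 powr (\<alpha> + 2) * C\<alpha> * \<delta> powr (1 + \<alpha>))"
      proof (rule expected_excess_risk_NN_le[OF P Q regQ k], unfold q_def[symmetric])
        show "(\<integral>\<^sup>+x. ennreal \<bar>\<eta>Q x - 1/2\<bar> * q x \<partial>?M) \<le> ennreal (K * 2 powr (\<alpha> + 2) * C\<alpha> * \<delta> powr (1 + \<alpha>))"
        proof (rule nn_integral_margin_le)
          show "measure ?M {x \<in> space ?M. 0 < \<bar>\<eta>Q x - 1/2\<bar> \<and> \<bar>\<eta>Q x - 1/2\<bar> < t} \<le> C\<alpha> * t powr \<alpha>" if "t > 0" for t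
            using margin that unfolding margin_condition_def by blast
          show "AE x in ?M. 0 < \<bar>\<eta>Q x - 1/2\<bar> \<longrightarrow> q x \<le> ennreal (K * (\<delta> / \<bar>\<eta>Q x - 1/2\<bar>) powr (\<alpha> + 2))"
            using AE_in_measure_support[OF sM] by eventually_elim (use qK in blast)
        qed (use q1 assms K \<delta> in \<open>auto intro: M.finite_measure_axioms\<close>)
      qed (use K assms in auto)
      also have "\<dots> = 2 * (K * 2 powr (\<alpha> + 2) * C\<alpha>) * \<delta> powr (1 + \<alpha>)" by simp
      also have "\<dots> \<le> C * \<delta> powr (1 + \<alpha>)" by (intro mult_right_mono) (auto simp: C_def)
      finally show ?thesis unfolding rate wP \<delta>_def[symmetric] .
    qed
  qed
  show ?thesis
  proof (intro exI[of _ C] conjI C allI impI)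
    fix nP nQ :: nat assume n: "nP + nQ \<ge> 1"
    let ?N = "real nP powr ((2 * \<beta> + d) / (2 * \<gamma> * \<beta> + d)) + real nQ"
    let ?wQ = "?N powr (- \<beta> / (2 * \<beta> + d))" and ?wP = "?N powr (- (\<gamma> * \<beta>) / (2 * \<beta> + d))"
    let ?kQ = "nat \<lfloor>real nQ * ?N powr (- d / (2 * \<beta> + d))\<rfloor>" and ?kP = "nat \<lfloor>real nP * ?N powr (- d / (2 * \<beta> + d))\<rfloor>"
    show "(let N = real nP powr ((2 * \<beta> + d) / (2 * \<gamma> * \<beta> + d)) + real nQ;
         wQ = N powr (- \<beta> / (2 * \<beta> + d));
         wP = N powr (- (\<gamma> * \<beta>) / (2 * \<beta> + d));
         kQ = nat \<lfloor>real nQ * N powr (- d / (2 * \<beta> + d))\<rfloor>;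
         kP = nat \<lfloor>real nP * N powr (- d / (2 * \<beta> + d))\<rfloor>
     in (SUP (P, Q, \<eta>P, \<eta>Q) \<in>
             (param_space \<alpha> C\<alpha> \<beta> C\<beta> \<gamma> C\<gamma> \<mu>m \<mu>p c\<mu> r\<mu> ::
               (((real ^ 'd) \<times> bool) measure \<times> ((real ^ 'd) \<times> bool) measure \<times>
                (real ^ 'd \<Rightarrow> real) \<times> (real ^ 'd \<Rightarrow> real)) set).
           ereal (expected_excess_risk_NN nP nQ wP wQ kP kQ P Q \<eta>Q))
        \<le> ereal (C * N powr (- (\<beta> * (1 + \<alpha>)) / (2 * \<beta> + d))))"
      unfolding Let_def
    proof (rule SUP_least, clarify)
      fix P Q :: "((real ^ 'd) \<times> bool) measure" and \<eta>P \<eta>Q :: "real ^ 'd \<Rightarrow> real"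
      assume "(P, Q, \<eta>P, \<eta>Q) \<in> param_space \<alpha> C\<alpha> \<beta> C\<beta> \<gamma> C\<gamma> \<mu>m \<mu>p c\<mu> r\<mu>"
      from main[OF n refl refl refl this, unfolded e_def]
      show "ereal (expected_excess_risk_NN nP nQ ?wP ?wQ ?kP ?kQ P Q \<eta>Q) \<le> ereal (C * ?N powr (- (\<beta> * (1 + \<alpha>)) / (2 * \<beta> + d)))"
        by simp
    qed
  qed
qed

end
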